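(* Let $M$ be a strictly pseudoconvex CR manifold and $\theta$ a contact form on $M$ with $G_\theta$ positive definite. Let $\gamma^s:[a,b]\to M$, $|s|<\epsilon$, be a $1$-parameter family of curves such that $(t,s)\mapsto\gamma^s(t)$ is differentiable on $[a,b]\times(-\epsilon,\epsilon)$ and each $\gamma^s$ is parametrized proportionally to arc length (with respect to $g_\theta$). Let $\gamma=\gamma^0$, let $L(\gamma^s)$ be the Riemannian length of $\gamma^s$ with respect to $g_\theta$, let $\sigma_t(s)=\gamma^s(t)$ and $X_{\gamma(t)}=\dot\sigma_t(0)$, $a\le t\le b$, and let $r=|\dot\gamma(t)|>0$ be the common length of all tangent vectors along $\gamma$. Then $$\frac{d}{ds}\{L(\gamma^s)\}_{s=0}=\frac1r\Big\{g_\theta(X,\dot\gamma)_{\gamma(b)}-g_\theta(X,\dot\gamma)_{\gamma(a)}-\int_a^b\big[g_\theta(X,\nabla_{\dot\gamma}\dot\gamma)-g_\theta(T_\nabla(X,\dot\gamma),\dot\gamma)\big]_{\gamma(t)}\,dt\Big\},$$ where $\nabla$ is the Tanaka-Webster connection of $(M,\theta)$ and $T_\nabla$ its torsion.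
   Context: Setting. $M$ is an orientable $C^\infty$ manifold of dimension $2n+1$ with a CR structure $T_{1,0}(M)\subset T(M)\otimes\mathbb C$ (a complex subbundle of complex rank $n$, with $T_{1,0}(M)\cap\overline{T_{1,0}(M)}=(0)$, closed under Lie brackets). $H(M)=\mathrm{Re}\{T_{1,0}(M)\oplus\overline{T_{1,0}(M)}\}$ is the Levi distribution, with complex structure $J(Z+\overline Z)=i(Z-\overline Z)$, $Z\in T_{1,0}(M)$. $\theta$ is a nowhere zero real $1$-form with $\mathrm{Ker}(\theta)=H(M)$; convention: $d\theta(X,Y)=\frac12\{X(\theta(Y))-Y(\theta(X))-\theta([X,Y])\}$. $G_\theta(X,Y)=(d\theta)(X,JY)$ on $H(M)$, assumed positive definite (strict pseudoconvexity). $T$ is the vector field with $\theta(T)=1$, $T\rfloor d\theta=0$; set $JT=0$. The Webster metric is the Riemannian metric $g_\theta$ with $g_\theta=G_\theta$ on $H(M)$, $g_\theta(X,T)=0$ for $X\in H(M)$, $g_\theta(T,T)=1$. The Tanaka-Webster connection $\nabla$ is the unique linear connection such that $H(M)$ is parallel, $\nabla g_\theta=0$, $\nabla J=0$, and its torsion $T_\nabla$ satisfies $T_\nabla(Z,W)=0$, $T_\nabla(Z,\overline W)=2(d\theta)(Z,\overline W)T$ for $Z,W\in T_{1,0}(M)$, and $\tau\circ J+J\circ\tau=0$, where $\tau(X)=T_\nabla(T,X)$. "Differentiable" means $C^\infty$. *)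

theory Defs
  imports "HOL-Analysis.Analysis"
begin

section \<open>Smooth maps between Euclidean spaces\<close>

text \<open>\<open>Ck_on k S f\<close>: for open \<open>S\<close>, all iterated directional derivatives of \<open>f\<close> of order at most \<open>k\<close>
  exist and are continuous on \<open>S\<close>. In finite dimension this is the usual class \<open>C\<close>-\<open>k\<close>.\<close>

primrec Ck_on ::
  "nat \<Rightarrow> 'a::real_normed_vector set \<Rightarrow> ('a \<Rightarrow> 'b::real_normed_vector) \<Rightarrow> bool" where
  "Ck_on 0 S f \<longleftrightarrow> continuous_on S f"
| "Ck_on (Suc k) S f \<longleftrightarrow>
     (\<forall>x\<in>S. f differentiable (at x)) \<and>
     (\<forall>v. Ck_on k S (\<lambda>x. frechet_derivative f (at x) v))"

definition smooth_on ::
  "'a::real_normed_vector set \<Rightarrow> ('a \<Rightarrow> 'b::real_normed_vector) \<Rightarrow> bool" where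
  "smooth_on S f \<longleftrightarrow> open S \<and> (\<forall>k. Ck_on k S f)"


section \<open>Smooth manifolds\<close>

text \<open>The manifold is the whole type \<open>'a\<close>. A chart is a pair of its domain and its coordinate map;
  the values of the coordinate map off the domain are irrelevant.\<close>

type_synonym ('a, 'm) chart = "'a set \<times> ('a \<Rightarrow> real^'m)"

definition chart_dom :: "('a, 'm) chart \<Rightarrow> 'a set" where
  "chart_dom c = fst c"

definition coord :: "('a, 'm) chart \<Rightarrow> 'a \<Rightarrow> real^'m" where
  "coord c = snd c"

definition param :: "('a, 'm) chart \<Rightarrow> real^'m \<Rightarrow> 'a" where
  "param c = inv_into (chart_dom c) (coord c)"

definition transition :: "('a, 'm) chart \<Rightarrow> ('a, 'm) chart \<Rightarrow> real^'m \<Rightarrow> real^'m" where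
  "transition c d = coord d \<circ> param c"

definition smooth_atlas :: "('a::topological_space, 'm::finite) chart set \<Rightarrow> bool" where
  "smooth_atlas A \<longleftrightarrow>
     (\<forall>c\<in>A. open (chart_dom c) \<and> open (coord c ` chart_dom c) \<and>
            homeomorphism (chart_dom c) (coord c ` chart_dom c) (coord c) (param c)) \<and>
     (\<Union>c\<in>A. chart_dom c) = UNIV \<and>
     (\<forall>c\<in>A. \<forall>d\<in>A. smooth_on (coord c ` (chart_dom c \<inter> chart_dom d)) (transition c d))"

definition orientable :: "('a::topological_space, 'm::finite) chart set \<Rightarrow> bool" where
  "orientable A \<longleftrightarrow>
     (\<exists>B. smooth_atlas B \<and> smooth_atlas (A \<union> B) \<and>
        (\<forall>c\<in>B. \<forall>d\<in>B. \<forall>p\<in>chart_dom c \<inter> chart_dom d.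
           det (matrix (frechet_derivative (transition c d) (at (coord c p)))) > 0))"

text \<open>The tangent space at \<open>p\<close> is modelled on \<open>real^'m\<close>: a vector \<open>v\<close> stands for the tangent vector
  at \<open>p\<close> whose components in the chosen chart \<open>chart_at A p\<close> are \<open>v\<close>. \<open>components A c p v\<close> are
  its components in any other chart \<open>c\<close> around \<open>p\<close>.\<close>

definition chart_at :: "('a, 'm) chart set \<Rightarrow> 'a \<Rightarrow> ('a, 'm) chart" where
  "chart_at A p = (SOME c. c \<in> A \<and> p \<in> chart_dom c)"

definition components ::
  "('a, 'm::finite) chart set \<Rightarrow> ('a, 'm) chart \<Rightarrow> 'a \<Rightarrow> real^'m \<Rightarrow> real^'m" where
  "components A c p v =
     frechet_derivative (transition (chart_at A p) c) (at (coord (chart_at A p) p)) v"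

text \<open>A vector field assigns to \<open>p\<close> an element of the tangent space at \<open>p\<close>. \<open>const_field A c v\<close> is the
  field on \<open>chart_dom c\<close> that has constant components \<open>v\<close> in the chart \<open>c\<close>; for \<open>c = chart_at A p\<close> it
  extends the tangent vector \<open>v\<close> at \<open>p\<close>.\<close>

type_synonym ('a, 'm) field = "'a \<Rightarrow> real^'m"

definition const_field ::
  "('a, 'm::finite) chart set \<Rightarrow> ('a, 'm) chart \<Rightarrow> real^'m \<Rightarrow> ('a, 'm) field" where
  "const_field A c v = (\<lambda>q. frechet_derivative (transition c (chart_at A q)) (at (coord c q)) v)"

definition field_rep ::
  "('a, 'm::finite) chart set \<Rightarrow> ('a, 'm) chart \<Rightarrow> ('a, 'm) field \<Rightarrow> real^'m \<Rightarrow> real^'m" where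
  "field_rep A c X = (\<lambda>x. components A c (param c x) (X (param c x)))"

definition smooth_field ::
  "('a::topological_space, 'm::finite) chart set \<Rightarrow> 'a set \<Rightarrow> ('a, 'm) field \<Rightarrow> bool" where
  "smooth_field A U X \<longleftrightarrow>
     open U \<and> (\<forall>c\<in>A. smooth_on (coord c ` (U \<inter> chart_dom c)) (field_rep A c X))"

definition smooth_fun ::
  "('a::topological_space, 'm::finite) chart set \<Rightarrow> 'a set \<Rightarrow> ('a \<Rightarrow> real) \<Rightarrow> bool" where
  "smooth_fun A U f \<longleftrightarrow>
     open U \<and> (\<forall>c\<in>A. smooth_on (coord c ` (U \<inter> chart_dom c)) (f \<circ> param c))"

definition dir_deriv ::
  "('a, 'm::finite) chart set \<Rightarrow> 'a \<Rightarrow> real^'m \<Rightarrow> ('a \<Rightarrow> real) \<Rightarrow> real" where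
  "dir_deriv A p v f =
     frechet_derivative (f \<circ> param (chart_at A p)) (at (coord (chart_at A p) p)) v"

text \<open>In coordinates, the \<open>k\<close>-th component of the Lie bracket of \<open>X\<close> and \<open>Y\<close> is
  \<open>X(Y\<^sub>k) - Y(X\<^sub>k)\<close>.\<close>

definition lie_bracket ::
  "('a, 'm::finite) chart set \<Rightarrow> ('a, 'm) field \<Rightarrow> ('a, 'm) field \<Rightarrow> ('a, 'm) field" where
  "lie_bracket A X Y p = (let c = chart_at A p in
     frechet_derivative (field_rep A c Y) (at (coord c p)) (X p) -
     frechet_derivative (field_rep A c X) (at (coord c p)) (Y p))"


section \<open>Forms, Riemannian metrics, connections\<close>

type_synonym ('a, 'm) form = "'a \<Rightarrow> real^'m \<Rightarrow> real"

definition one_form ::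
  "('a::topological_space, 'm::finite) chart set \<Rightarrow> ('a, 'm) form \<Rightarrow> bool" where
  "one_form A \<theta> \<longleftrightarrow>
     (\<forall>p. linear (\<theta> p)) \<and>
     (\<forall>U X. smooth_field A U X \<longrightarrow> smooth_fun A U (\<lambda>p. \<theta> p (X p)))"

text \<open>The exterior derivative carries the factor \<open>1/2\<close>. It is tensorial, so its value on tangent
  vectors at a point is obtained from arbitrary extensions to vector fields.\<close>

definition ext_deriv_fields ::
  "('a, 'm::finite) chart set \<Rightarrow> ('a, 'm) form \<Rightarrow>
   ('a, 'm) field \<Rightarrow> ('a, 'm) field \<Rightarrow> 'a \<Rightarrow> real" where
  "ext_deriv_fields A \<theta> X Y p =
     1 / 2 * (dir_deriv A p (X p) (\<lambda>q. \<theta> q (Y q)) - dir_deriv A p (Y p) (\<lambda>q. \<theta> q (X q))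
              - \<theta> p (lie_bracket A X Y p))"

definition ext_deriv ::
  "('a, 'm::finite) chart set \<Rightarrow> ('a, 'm) form \<Rightarrow> 'a \<Rightarrow> real^'m \<Rightarrow> real^'m \<Rightarrow> real" where
  "ext_deriv A \<theta> p v w = (let c = chart_at A p in
     ext_deriv_fields A \<theta> (const_field A c v) (const_field A c w) p)"

type_synonym ('a, 'm) metric = "'a \<Rightarrow> real^'m \<Rightarrow> real^'m \<Rightarrow> real"

definition riemannian_metric ::
  "('a::topological_space, 'm::finite) chart set \<Rightarrow> ('a, 'm) metric \<Rightarrow> bool" where
  "riemannian_metric A g \<longleftrightarrow>
     (\<forall>p. bilinear (g p) \<and> (\<forall>v w. g p v w = g p w v) \<and> (\<forall>v. v \<noteq> 0 \<longrightarrow> g p v v > 0)) \<and>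
     (\<forall>U X Y. smooth_field A U X \<longrightarrow> smooth_field A U Y \<longrightarrow>
        smooth_fun A U (\<lambda>p. g p (X p) (Y p)))"

text \<open>A linear connection acts on locally defined vector fields: \<open>nab p v Y\<close> is the covariant
  derivative at \<open>p\<close>, in the direction of the tangent vector \<open>v\<close>, of a field \<open>Y\<close> that is smooth on some
  open neighbourhood of \<open>p\<close>. Nothing is said about \<open>nab p v Y\<close> for other \<open>Y\<close>.\<close>

type_synonym ('a, 'm) connection = "'a \<Rightarrow> real^'m \<Rightarrow> ('a, 'm) field \<Rightarrow> real^'m"

definition linear_connection ::
  "('a::topological_space, 'm::finite) chart set \<Rightarrow> ('a, 'm) connection \<Rightarrow> bool" where
  "linear_connection A nab \<longleftrightarrow>
     (\<forall>U Y Y' p v. smooth_field A U Y \<longrightarrow> p \<in> U \<longrightarrow> (\<forall>q\<in>U. Y' q = Y q) \<longrightarrow>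
        nab p v Y' = nab p v Y) \<and>
     (\<forall>U Y p. smooth_field A U Y \<longrightarrow> p \<in> U \<longrightarrow> linear (\<lambda>v. nab p v Y)) \<and>
     (\<forall>U Y Z p v. smooth_field A U Y \<longrightarrow> smooth_field A U Z \<longrightarrow> p \<in> U \<longrightarrow>
        nab p v (\<lambda>q. Y q + Z q) = nab p v Y + nab p v Z) \<and>
     (\<forall>U f Y p v. smooth_fun A U f \<longrightarrow> smooth_field A U Y \<longrightarrow> p \<in> U \<longrightarrow>
        nab p v (\<lambda>q. f q *\<^sub>R Y q) = dir_deriv A p v f *\<^sub>R Y p + f p *\<^sub>R nab p v Y) \<and>
     (\<forall>U X Y. smooth_field A U X \<longrightarrow> smooth_field A U Y \<longrightarrow>
        smooth_field A U (\<lambda>p. nab p (X p) Y))"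

definition torsion_fields ::
  "('a, 'm::finite) chart set \<Rightarrow> ('a, 'm) connection \<Rightarrow>
   ('a, 'm) field \<Rightarrow> ('a, 'm) field \<Rightarrow> ('a, 'm) field" where
  "torsion_fields A nab X Y p = nab p (X p) Y - nab p (Y p) X - lie_bracket A X Y p"

text \<open>As for the exterior derivative, the value on tangent vectors is independent of the extension.\<close>

definition torsion ::
  "('a, 'm::finite) chart set \<Rightarrow> ('a, 'm) connection \<Rightarrow>
   'a \<Rightarrow> real^'m \<Rightarrow> real^'m \<Rightarrow> real^'m" where
  "torsion A nab p v w = (let c = chart_at A p in
     torsion_fields A nab (const_field A c v) (const_field A c w) p)"


section \<open>The complexified tangent bundle and CR structures\<close>

text \<open>The complexification of the tangent space \<open>real^'m\<close> is \<open>complex^'m\<close>.\<close>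

definition cplx :: "real^'m \<Rightarrow> real^'m \<Rightarrow> complex^'m" where
  "cplx x y = (\<chi> i. Complex (x $ i) (y $ i))"

definition Re_vec :: "complex^'m \<Rightarrow> real^'m" where
  "Re_vec z = (\<chi> i. Re (z $ i))"

definition Im_vec :: "complex^'m \<Rightarrow> real^'m" where
  "Im_vec z = (\<chi> i. Im (z $ i))"

definition cnj_vec :: "complex^'m \<Rightarrow> complex^'m" where
  "cnj_vec z = (\<chi> i. cnj (z $ i))"

text \<open>Complex bilinear extensions of real bilinear maps.\<close>

definition cbilin :: "(real^'m \<Rightarrow> real^'m \<Rightarrow> real^'m) \<Rightarrow> complex^'m \<Rightarrow> complex^'m \<Rightarrow> complex^'m" where
  "cbilin B z w =
     cplx (B (Re_vec z) (Re_vec w) - B (Im_vec z) (Im_vec w))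
          (B (Re_vec z) (Im_vec w) + B (Im_vec z) (Re_vec w))"

definition cbilin_form :: "(real^'m \<Rightarrow> real^'m \<Rightarrow> real) \<Rightarrow> complex^'m \<Rightarrow> complex^'m \<Rightarrow> complex" where
  "cbilin_form B z w =
     Complex (B (Re_vec z) (Re_vec w) - B (Im_vec z) (Im_vec w))
             (B (Re_vec z) (Im_vec w) + B (Im_vec z) (Re_vec w))"

type_synonym ('a, 'm) cfield = "'a \<Rightarrow> complex^'m"

definition smooth_cfield ::
  "('a::topological_space, 'm::finite) chart set \<Rightarrow> 'a set \<Rightarrow> ('a, 'm) cfield \<Rightarrow> bool" where
  "smooth_cfield A U Z \<longleftrightarrow>
     smooth_field A U (\<lambda>p. Re_vec (Z p)) \<and> smooth_field A U (\<lambda>p. Im_vec (Z p))"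

definition clie_bracket ::
  "('a, 'm::finite) chart set \<Rightarrow> ('a, 'm) cfield \<Rightarrow> ('a, 'm) cfield \<Rightarrow> ('a, 'm) cfield" where
  "clie_bracket A Z W p =
     (let X = (\<lambda>q. Re_vec (Z q)); X' = (\<lambda>q. Im_vec (Z q));
          Y = (\<lambda>q. Re_vec (W q)); Y' = (\<lambda>q. Im_vec (W q))
      in cplx (lie_bracket A X Y p - lie_bracket A X' Y' p)
              (lie_bracket A X Y' p + lie_bracket A X' Y p))"

type_synonym ('a, 'm) cdistribution = "'a \<Rightarrow> (complex^'m) set"

definition complex_subbundle ::
  "('a::topological_space, 'm::finite) chart set \<Rightarrow> nat \<Rightarrow> ('a, 'm) cdistribution \<Rightarrow> bool" where
  "complex_subbundle A n E \<longleftrightarrow>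
     (\<forall>p. vec.subspace (E p) \<and> vec.dim (E p) = n) \<and>
     (\<forall>p. \<exists>U Z. open U \<and> p \<in> U \<and> (\<forall>i<n. smooth_cfield A U (Z i)) \<and>
        (\<forall>q\<in>U. E q = vec.span ((\<lambda>i. Z i q) ` {..<n})))"

definition cr_structure ::
  "('a::topological_space, 'm::finite) chart set \<Rightarrow> nat \<Rightarrow> ('a, 'm) cdistribution \<Rightarrow> bool" where
  "cr_structure A n T10 \<longleftrightarrow>
     complex_subbundle A n T10 \<and>
     (\<forall>p. T10 p \<inter> cnj_vec ` T10 p = {0}) \<and>
     (\<forall>U Z W. smooth_cfield A U Z \<longrightarrow> smooth_cfield A U W \<longrightarrow>
        (\<forall>p\<in>U. Z p \<in> T10 p \<and> W p \<in> T10 p) \<longrightarrow> (\<forall>p\<in>U. clie_bracket A Z W p \<in> T10 p))"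

definition levi_distribution :: "('a, 'm::finite) cdistribution \<Rightarrow> 'a \<Rightarrow> (real^'m) set" where
  "levi_distribution T10 p = Re_vec ` {z + cnj_vec w |z w. z \<in> T10 p \<and> w \<in> T10 p}"


section \<open>Pseudohermitian structures\<close>

definition pseudohermitian_form ::
  "('a::topological_space, 'm::finite) chart set \<Rightarrow> ('a, 'm) cdistribution \<Rightarrow> ('a, 'm) form \<Rightarrow> bool" where
  "pseudohermitian_form A T10 \<theta> \<longleftrightarrow>
     one_form A \<theta> \<and> (\<forall>p. \<exists>v. \<theta> p v \<noteq> 0) \<and>
     (\<forall>p. {v. \<theta> p v = 0} = levi_distribution T10 p)"

definition characteristic_field ::
  "('a::topological_space, 'm::finite) chart set \<Rightarrow> ('a, 'm) form \<Rightarrow> ('a, 'm) field \<Rightarrow> bool" where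
  "characteristic_field A \<theta> T \<longleftrightarrow>
     smooth_field A UNIV T \<and> (\<forall>p. \<theta> p (T p) = 1) \<and> (\<forall>p v. ext_deriv A \<theta> p (T p) v = 0)"

text \<open>The complex structure of the Levi distribution, extended to the tangent bundle by \<open>J T = 0\<close>.\<close>

definition cr_complex_structure ::
  "('a, 'm::finite) cdistribution \<Rightarrow> ('a, 'm) field \<Rightarrow> ('a \<Rightarrow> real^'m \<Rightarrow> real^'m) \<Rightarrow> bool" where
  "cr_complex_structure T10 T J \<longleftrightarrow>
     (\<forall>p. linear (J p) \<and> J p (T p) = 0 \<and>
        (\<forall>z\<in>T10 p. cplx (J p (Re_vec (z + cnj_vec z))) 0 = \<i> *s (z - cnj_vec z)))"

definition levi_form ::
  "('a, 'm::finite) chart set \<Rightarrow> ('a, 'm) form \<Rightarrow> ('a \<Rightarrow> real^'m \<Rightarrow> real^'m) \<Rightarrow> ('a, 'm) metric" where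
  "levi_form A \<theta> J p v w = ext_deriv A \<theta> p v (J p w)"

definition levi_positive_definite ::
  "('a, 'm::finite) chart set \<Rightarrow> ('a, 'm) cdistribution \<Rightarrow> ('a, 'm) form \<Rightarrow>
   ('a \<Rightarrow> real^'m \<Rightarrow> real^'m) \<Rightarrow> bool" where
  "levi_positive_definite A T10 \<theta> J \<longleftrightarrow>
     (\<forall>p. \<forall>v\<in>levi_distribution T10 p. v \<noteq> 0 \<longrightarrow> levi_form A \<theta> J p v v > 0)"

definition webster_metric ::
  "('a::topological_space, 'm::finite) chart set \<Rightarrow> ('a, 'm) cdistribution \<Rightarrow> ('a, 'm) form \<Rightarrow>
   ('a, 'm) field \<Rightarrow> ('a \<Rightarrow> real^'m \<Rightarrow> real^'m) \<Rightarrow> ('a, 'm) metric \<Rightarrow> bool" where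
  "webster_metric A T10 \<theta> T J g \<longleftrightarrow>
     riemannian_metric A g \<and>
     (\<forall>p. \<forall>v\<in>levi_distribution T10 p. \<forall>w\<in>levi_distribution T10 p.
        g p v w = levi_form A \<theta> J p v w) \<and>
     (\<forall>p. \<forall>v\<in>levi_distribution T10 p. g p v (T p) = 0) \<and>
     (\<forall>p. g p (T p) (T p) = 1)"

text \<open>The conjuncts say, in this order: the Levi distribution is parallel, \<open>g\<close> is parallel, \<open>J\<close> is
  parallel, and the three torsion conditions (the first two for the complex bilinear extension).\<close>

definition tanaka_webster_connection ::
  "('a::topological_space, 'm::finite) chart set \<Rightarrow> ('a, 'm) cdistribution \<Rightarrow> ('a, 'm) form \<Rightarrow>
   ('a, 'm) field \<Rightarrow> ('a \<Rightarrow> real^'m \<Rightarrow> real^'m) \<Rightarrow> ('a, 'm) metric \<Rightarrow>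
   ('a, 'm) connection \<Rightarrow> bool" where
  "tanaka_webster_connection A T10 \<theta> T J g nab \<longleftrightarrow>
     linear_connection A nab \<and>
     (\<forall>U Y. smooth_field A U Y \<longrightarrow> (\<forall>q\<in>U. Y q \<in> levi_distribution T10 q) \<longrightarrow>
        (\<forall>p\<in>U. \<forall>v. nab p v Y \<in> levi_distribution T10 p)) \<and>
     (\<forall>U Y Z. smooth_field A U Y \<longrightarrow> smooth_field A U Z \<longrightarrow>
        (\<forall>p\<in>U. \<forall>v. dir_deriv A p v (\<lambda>q. g q (Y q) (Z q)) =
           g p (nab p v Y) (Z p) + g p (Y p) (nab p v Z))) \<and>
     (\<forall>U Y. smooth_field A U Y \<longrightarrow>
        (\<forall>p\<in>U. \<forall>v. nab p v (\<lambda>q. J q (Y q)) = J p (nab p v Y))) \<and>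
     (\<forall>p. \<forall>z\<in>T10 p. \<forall>w\<in>T10 p. cbilin (torsion A nab p) z w = 0) \<and>
     (\<forall>p. \<forall>z\<in>T10 p. \<forall>w\<in>T10 p. cbilin (torsion A nab p) z (cnj_vec w) =
        (2 * cbilin_form (ext_deriv A \<theta> p) z (cnj_vec w)) *s cplx (T p) 0) \<and>
     (\<forall>p v. torsion A nab p (T p) (J p v) + J p (torsion A nab p (T p) v) = 0)"


section \<open>Curves\<close>

text \<open>A map on an arbitrary set is smooth if it extends, locally around each point of the set, to a
  smooth map on an open set.\<close>

definition smooth_map_on ::
  "('a::topological_space, 'm::finite) chart set \<Rightarrow> 'b::real_normed_vector set \<Rightarrow> ('b \<Rightarrow> 'a) \<Rightarrow> bool" where
  "smooth_map_on A S F \<longleftrightarrow>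
     (\<forall>x\<in>S. \<exists>W F'. open W \<and> x \<in> W \<and> (\<forall>y\<in>S \<inter> W. F' y = F y) \<and> continuous_on W F' \<and>
        (\<forall>c\<in>A. smooth_on (W \<inter> F' -` chart_dom c) (coord c \<circ> F')))"

definition velocity ::
  "('a, 'm::finite) chart set \<Rightarrow> real set \<Rightarrow> (real \<Rightarrow> 'a) \<Rightarrow> real \<Rightarrow> real^'m" where
  "velocity A I \<gamma> t = vector_derivative (coord (chart_at A (\<gamma> t)) \<circ> \<gamma>) (at t within I)"

definition speed ::
  "('a, 'm::finite) chart set \<Rightarrow> ('a, 'm) metric \<Rightarrow> real set \<Rightarrow> (real \<Rightarrow> 'a) \<Rightarrow> real \<Rightarrow> real" where
  "speed A g I \<gamma> t = sqrt (g (\<gamma> t) (velocity A I \<gamma> t) (velocity A I \<gamma> t))"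

definition curve_length ::
  "('a, 'm::finite) chart set \<Rightarrow> ('a, 'm) metric \<Rightarrow> real \<Rightarrow> real \<Rightarrow> (real \<Rightarrow> 'a) \<Rightarrow> real" where
  "curve_length A g a b \<gamma> = integral {a..b} (speed A g {a..b} \<gamma>)"

definition proportional_to_arclength ::
  "('a, 'm::finite) chart set \<Rightarrow> ('a, 'm) metric \<Rightarrow> real \<Rightarrow> real \<Rightarrow> (real \<Rightarrow> 'a) \<Rightarrow> bool" where
  "proportional_to_arclength A g a b \<gamma> \<longleftrightarrow>
     (\<exists>k. \<forall>t\<in>{a..b}. curve_length A g a t \<gamma> = k * (t - a))"

text \<open>The covariant derivative along \<open>\<gamma>\<close> of a field \<open>V\<close> along \<open>\<gamma>\<close>. Near \<open>t\<close> write
  \<open>V = \<Sum>\<^sub>j V\<^sub>j E\<^sub>j\<close> in the coordinate frame of a chart \<open>c\<close> around \<open>\<gamma> t\<close>. The derivative is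
  \<open>\<Sum>\<^sub>j (V\<^sub>j' E\<^sub>j + V\<^sub>j \<nabla>\<^bsub>\<gamma>'\<^esub> E\<^sub>j)\<close>; its second part is the derivative of the field with the
  constant components \<open>V\<^sub>j(t)\<close>.\<close>

definition cov_deriv_along ::
  "('a, 'm::finite) chart set \<Rightarrow> ('a, 'm) connection \<Rightarrow> real set \<Rightarrow> (real \<Rightarrow> 'a) \<Rightarrow>
   (real \<Rightarrow> real^'m) \<Rightarrow> real \<Rightarrow> real^'m" where
  "cov_deriv_along A nab I \<gamma> V t = (let c = chart_at A (\<gamma> t) in
     vector_derivative (\<lambda>u. components A c (\<gamma> u) (V u)) (at t within I)
     + nab (\<gamma> t) (velocity A I \<gamma> t) (const_field A c (V t)))"

end

theory Submission
  imports Defs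
begin

text \<open>In the coordinate frame of a chart the metric is a smooth family of bilinear forms, and
  parallelism of the metric expresses its derivatives by the covariant derivatives of the coordinate
  fields. Since mixed partial derivatives are equal and coordinate fields commute, half the
  \<open>s\<close>-derivative of the squared speed is \<open>d/dt g(X, \<gamma>') - g(X, \<nabla>\<^bsub>\<gamma>'\<^esub> \<gamma>') + g(T(X, \<gamma>'), \<gamma>')\<close>. The curves
  have constant speed, so their lengths are \<open>b - a\<close> times the speed at any chosen time, and this
  expression, which is thus the same for all \<open>t\<close>, only has to be integrated over \<open>t\<close>.\<close>

section \<open>Calculus of \<open>Ck_on\<close>\<close>

text \<open>The obstacle is the model of the tangent bundle: a vector at \<open>p\<close> is written
  in the chart \<open>chart_at A p\<close>, and these charts are chosen independently at each point.
  As maps into \<open>real^'m\<close>, the velocity, the field \<open>X\<close> and the metric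
  coefficients need not even be continuous, so none of them can be differentiated directly. Near
  each parameter everything is therefore rewritten in one fixed chart, where the family is a smooth
  map \<open>f\<close> of two real variables and the velocities are its partial derivatives. Since
  \<open>f\<close> comes from a local extension beyond the closed interval, the ends
  \<open>a\<close> and \<open>b\<close> need no separate treatment. The torsion enters because
  \<nabla> differentiates coordinate fields: exchanging the two directions costs \<nabla>_X E_v -
  \<nabla>_v E_X, where E_w is the coordinate field extending w and v is the velocity.\<close>

lemma Ck_on_cong:
  assumes "open S" "\<And>x. x \<in> S \<Longrightarrow> f x = f' x" "Ck_on k S f"
  shows "Ck_on k S f'"
  using assms(2,3)
proof (induction k arbitrary: f f')
  case 0
  then show ?case by (simp cong: continuous_on_cong)
next
  case (Suc k)
  have "f' differentiable (at x)" if "x \<in> S" for x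
    using Suc.prems that assms(1) has_derivative_transform_within_open
    unfolding differentiable_def by (metis Ck_on.simps(2) differentiable_def)
  moreover have "Ck_on k S (\<lambda>x. frechet_derivative f' (at x) v)" for v
  proof (rule Suc.IH)
    show "Ck_on k S (\<lambda>x. frechet_derivative f (at x) v)"
      using Suc.prems by simp
    show "frechet_derivative f (at x) v = frechet_derivative f' (at x) v" if "x \<in> S" for x
      using frechet_derivative_transform_within_open[of f x S f'] Suc.prems assms(1) that by simp
  qed
  ultimately show ?case by simp
qed

text \<open>The recursion demands continuity only at the last order. At the lower orders it follows
  from differentiability.\<close>

lemma Ck_on_Suc_imp: "Ck_on (Suc k) S f \<Longrightarrow> Ck_on k S f"
proof (induction k arbitrary: f)
  case 0
  then show ?case
    by (simp add: continuous_at_imp_continuous_on differentiable_imp_continuous_within)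
next
  case (Suc k)
  have "Ck_on k S (\<lambda>x. frechet_derivative f (at x) v)" for v
    using Suc.prems by (intro Suc.IH) simp
  with Suc.prems show ?case by simp
qed

lemma frechet_derivativeI: "(f has_derivative D) (at x) \<Longrightarrow> frechet_derivative f (at x) = D"
  using frechet_derivative_at by metis

lemma Ck_on_const: "Ck_on k S (\<lambda>x. c)"
  by (induction k arbitrary: c) simp_all

lemma Ck_on_add:
  assumes "open S" "Ck_on k S f" "Ck_on k S g"
  shows "Ck_on k S (\<lambda>x. f x + g x)"
  using assms(2,3)
proof (induction k arbitrary: f g)
  case 0
  then show ?case by (simp add: continuous_on_add)
next
  case (Suc k)
  have D: "((\<lambda>x. f x + g x) has_derivative
      (\<lambda>v. frechet_derivative f (at x) v + frechet_derivative g (at x) v)) (at x)" if "x \<in> S" for x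
    using Suc.prems that
    by (intro has_derivative_add) (simp_all add: frechet_derivative_works[symmetric])
  have "Ck_on k S (\<lambda>x. frechet_derivative (\<lambda>x. f x + g x) (at x) v)" for v
    by (rule Ck_on_cong[OF assms(1) _ Suc.IH[of "\<lambda>x. frechet_derivative f (at x) v"
          "\<lambda>x. frechet_derivative g (at x) v"]])
      (use Suc.prems in \<open>simp_all add: frechet_derivativeI[OF D]\<close>)
  then show ?case using D by (auto simp: differentiable_def)
qed

lemma Ck_on_sum:
  assumes "open S" "\<And>i. i \<in> I \<Longrightarrow> Ck_on k S (f i)"
  shows "Ck_on k S (\<lambda>x. \<Sum>i\<in>I. f i x)"
  using assms(2)
  by (induction I rule: infinite_finite_induct) (auto intro: Ck_on_const Ck_on_add assms(1))

lemma Ck_on_bounded_linear: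
  assumes "open S" "bounded_linear L" "Ck_on k S f"
  shows "Ck_on k S (\<lambda>x. L (f x))"
  using assms(3)
proof (induction k arbitrary: f)
  case 0
  then show ?case by (simp add: bounded_linear.continuous_on[OF assms(2)])
next
  case (Suc k)
  have D: "((\<lambda>x. L (f x)) has_derivative (\<lambda>v. L (frechet_derivative f (at x) v))) (at x)"
    if "x \<in> S" for x
    using Suc.prems that
    by (intro bounded_linear.has_derivative[OF assms(2)]) (simp add: frechet_derivative_works[symmetric])
  have "Ck_on k S (\<lambda>x. frechet_derivative (\<lambda>x. L (f x)) (at x) v)" for v
    by (rule Ck_on_cong[OF assms(1) _ Suc.IH[of "\<lambda>x. frechet_derivative f (at x) v"]])
      (use Suc.prems in \<open>simp_all add: frechet_derivativeI[OF D]\<close>)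
  then show ?case using D by (auto simp: differentiable_def)
qed

text \<open>The product rule pairs a derivative with an undifferentiated factor; the latter has one
  order to spare, so the induction hypothesis applies to both summands.\<close>

lemma Ck_on_scaleR:
  assumes "open S" "Ck_on k S f" "Ck_on k S g"
  shows "Ck_on k S (\<lambda>x. f x *\<^sub>R g x)"
  using assms(2,3)
proof (induction k arbitrary: f g)
  case 0
  then show ?case by (simp add: continuous_on_scaleR)
next
  case (Suc k)
  have D: "((\<lambda>x. f x *\<^sub>R g x) has_derivative (\<lambda>v. f x *\<^sub>R frechet_derivative g (at x) v +
      frechet_derivative f (at x) v *\<^sub>R g x)) (at x)" if "x \<in> S" for x
    using Suc.prems that
    by (intro has_derivative_scaleR) (simp_all add: frechet_derivative_works[symmetric])
  have "Ck_on k S (\<lambda>x. frechet_derivative (\<lambda>x. f x *\<^sub>R g x) (at x) v)" for v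
  proof (rule Ck_on_cong[OF assms(1)])
    show "Ck_on k S (\<lambda>x. f x *\<^sub>R frechet_derivative g (at x) v +
      frechet_derivative f (at x) v *\<^sub>R g x)"
      using Suc.prems Ck_on_Suc_imp[OF Suc.prems(1)] Ck_on_Suc_imp[OF Suc.prems(2)]
      by (intro Ck_on_add[OF assms(1)] Suc.IH) simp_all
  qed (simp add: frechet_derivativeI[OF D])
  then show ?case using D by (auto simp: differentiable_def)
qed

text \<open>The chain rule differentiates \<open>f\<close> in a direction that varies with the
  point, whereas \<open>Ck_on\<close> speaks of fixed directions only. Expanding the direction in a
  basis leaves products of coefficients with fixed directional derivatives of \<open>f\<close>,
  composed with \<open>g\<close>; hence the Euclidean domain of \<open>f\<close>.\<close>

lemma Ck_on_compose:
  fixes f :: "'b::euclidean_space \<Rightarrow> 'c::real_normed_vector"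
  assumes "open S" "g ` S \<subseteq> T" "Ck_on k T f" "Ck_on k S g"
  shows "Ck_on k S (f \<circ> g)"
  using assms(3,4)
proof (induction k arbitrary: f)
  case 0
  then show ?case
    using assms(2) by (simp add: continuous_on_compose continuous_on_subset del: o_apply)
next
  case (Suc k)
  have f: "(f has_derivative frechet_derivative f (at (g x))) (at (g x))" if "x \<in> S" for x
    using Suc.prems that assms(2) by (auto simp: frechet_derivative_works[symmetric])
  have D: "((f \<circ> g) has_derivative
      frechet_derivative f (at (g x)) \<circ> frechet_derivative g (at x)) (at x)" if "x \<in> S" for x
    using Suc.prems that
    by (intro diff_chain_at f) (simp_all add: frechet_derivative_works[symmetric])
  have "Ck_on k S (\<lambda>x. frechet_derivative (f \<circ> g) (at x) v)" for v
  proof (rule Ck_on_cong[OF assms(1)])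
    show "Ck_on k S (\<lambda>x. \<Sum>i\<in>Basis. (frechet_derivative g (at x) v \<bullet> i) *\<^sub>R
       ((\<lambda>y. frechet_derivative f (at y) i) \<circ> g) x)"
      using Suc.prems Ck_on_Suc_imp[OF Suc.prems(2)]
      by (intro Ck_on_sum Ck_on_scaleR Suc.IH assms(1)
          Ck_on_bounded_linear[of S "\<lambda>z. z \<bullet> _"] bounded_linear_inner_left) simp_all
    show "(\<Sum>i\<in>Basis. (frechet_derivative g (at x) v \<bullet> i) *\<^sub>R
       ((\<lambda>y. frechet_derivative f (at y) i) \<circ> g) x) = frechet_derivative (f \<circ> g) (at x) v"
      if "x \<in> S" for x
    proof -
      interpret linear "frechet_derivative f (at (g x))"
        using f[OF that] has_derivative_linear by blast
      define w where "w = frechet_derivative g (at x) v"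
      have "frechet_derivative f (at (g x)) w =
          frechet_derivative f (at (g x)) (\<Sum>i\<in>Basis. (w \<bullet> i) *\<^sub>R i)"
        by (simp only: euclidean_representation)
      also have "\<dots> = (\<Sum>i\<in>Basis. (w \<bullet> i) *\<^sub>R frechet_derivative f (at (g x)) i)"
        by (simp only: sum scale)
      finally show ?thesis
        by (simp only: frechet_derivativeI[OF D[OF that]] o_apply w_def)
    qed
  qed
  then show ?case using D unfolding Ck_on.simps differentiable_def by blast
qed

lemma smooth_on_has_derivative:
  assumes "smooth_on S f" "x \<in> S"
  shows "(f has_derivative frechet_derivative f (at x)) (at x)"
proof -
  have "Ck_on (Suc 0) S f" using assms(1) unfolding smooth_on_def by blast
  then show ?thesis using assms(2) by (simp add: frechet_derivative_works[symmetric])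
qed

lemma smooth_on_frechet_derivative:
  assumes "smooth_on S f"
  shows "smooth_on S (\<lambda>x. frechet_derivative f (at x) v)"
proof -
  have "Ck_on k S (\<lambda>x. frechet_derivative f (at x) v)" for k
  proof -
    have "Ck_on (Suc k) S f" using assms unfolding smooth_on_def by blast
    then show ?thesis by simp
  qed
  then show ?thesis using assms unfolding smooth_on_def by simp
qed

lemma smooth_on_compose:
  fixes f :: "'b::euclidean_space \<Rightarrow> 'c::real_normed_vector"
  assumes "smooth_on T f" "smooth_on S g" "g ` S \<subseteq> T"
  shows "smooth_on S (f \<circ> g)"
  using assms(1,2) unfolding smooth_on_def by (auto intro: Ck_on_compose[OF _ assms(3)])

lemma smooth_on_cong:
  assumes "smooth_on S f" "\<And>x. x \<in> S \<Longrightarrow> f x = f' x"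
  shows "smooth_on S f'"
  using assms(1) unfolding smooth_on_def by (auto intro: Ck_on_cong[OF _ assms(2)])

section \<open>Symmetry of second derivatives\<close>

text \<open>Two uses of the mean value theorem: along \<open>u\<close> for the increment of
  \<open>f\<close> in direction \<open>h *\<^sub>R v\<close>, then along \<open>v\<close> for the
  derivative of \<open>f\<close> in direction \<open>u\<close>. The left-hand side is symmetric in
  \<open>u\<close> and \<open>v\<close>, which is what makes the formula useful.\<close>

lemma second_difference:
  fixes f :: "'a::real_normed_vector \<Rightarrow> real"
  assumes "smooth_on S f" "0 < h"
    and S: "\<And>\<xi> \<eta>. 0 \<le> \<xi> \<Longrightarrow> \<xi> \<le> h \<Longrightarrow> 0 \<le> \<eta> \<Longrightarrow> \<eta> \<le> h \<Longrightarrow> p + \<xi> *\<^sub>R u + \<eta> *\<^sub>R v \<in> S"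
  obtains \<xi> \<eta> where "0 < \<xi>" "\<xi> < h" "0 < \<eta>" "\<eta> < h"
    "f (p + h *\<^sub>R u + h *\<^sub>R v) - f (p + h *\<^sub>R u) - f (p + h *\<^sub>R v) + f p =
     h * h * frechet_derivative (\<lambda>x. frechet_derivative f (at x) u) (at (p + \<xi> *\<^sub>R u + \<eta> *\<^sub>R v)) v"
proof -
  define f1 where "f1 = (\<lambda>x. frechet_derivative f (at x) u)"
  have f1: "smooth_on S f1"
    unfolding f1_def by (rule smooth_on_frechet_derivative[OF assms(1)])
  have line: "((\<lambda>z. k (q + z *\<^sub>R w)) has_real_derivative frechet_derivative k (at (q + z *\<^sub>R w)) w) (at z)"
    if "smooth_on S k" "q + z *\<^sub>R w \<in> S" for k :: "'a \<Rightarrow> real" and q z w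
  proof -
    note D = smooth_on_has_derivative[OF that]
    have "((\<lambda>z. k (q + z *\<^sub>R w)) has_derivative
        (\<lambda>y. frechet_derivative k (at (q + z *\<^sub>R w)) (y *\<^sub>R w))) (at z)"
      by (rule has_derivative_compose[of "\<lambda>z. q + z *\<^sub>R w" _ _ _ k])
        (use D in \<open>auto intro!: derivative_eq_intros\<close>)
    moreover have "(\<lambda>y. frechet_derivative k (at (q + z *\<^sub>R w)) (y *\<^sub>R w)) =
        (*) (frechet_derivative k (at (q + z *\<^sub>R w)) w)"
      using linear_scale[OF has_derivative_linear[OF D]] by (simp add: fun_eq_iff)
    ultimately show ?thesis by (simp add: has_field_derivative_def)
  qed
  have "((\<lambda>z. f (p + h *\<^sub>R v + z *\<^sub>R u) - f (p + z *\<^sub>R u)) has_real_derivative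
      f1 (p + h *\<^sub>R v + z *\<^sub>R u) - f1 (p + z *\<^sub>R u)) (at z)" if "0 \<le> z" "z \<le> h" for z
    unfolding f1_def using that S[of z h] S[of z 0] assms(2)
    by (intro DERIV_diff line[OF assms(1)]) (simp_all add: algebra_simps)
  from MVT2[OF assms(2) this]
  obtain \<xi> where \<xi>: "0 < \<xi>" "\<xi> < h"
    "f (p + h *\<^sub>R v + h *\<^sub>R u) - f (p + h *\<^sub>R u) - (f (p + h *\<^sub>R v) - f p) =
      h * (f1 (p + h *\<^sub>R v + \<xi> *\<^sub>R u) - f1 (p + \<xi> *\<^sub>R u))" by auto
  have "((\<lambda>z. f1 (p + \<xi> *\<^sub>R u + z *\<^sub>R v)) has_real_derivative
      frechet_derivative f1 (at (p + \<xi> *\<^sub>R u + z *\<^sub>R v)) v) (at z)" if "0 \<le> z" "z \<le> h" for z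
    using that S[of \<xi> z] \<xi> by (intro line[OF f1]) auto
  from MVT2[OF assms(2) this]
  obtain \<eta> where \<eta>: "0 < \<eta>" "\<eta> < h"
    "f1 (p + \<xi> *\<^sub>R u + h *\<^sub>R v) - f1 (p + \<xi> *\<^sub>R u) =
      h * frechet_derivative f1 (at (p + \<xi> *\<^sub>R u + \<eta> *\<^sub>R v)) v" by auto
  show thesis
    by (rule that[OF \<xi>(1,2) \<eta>(1,2)])
      (use \<xi>(3) \<eta>(3) in \<open>simp add: f1_def algebra_simps\<close>)
qed

text \<open>One and the same second difference is a value of either mixed derivative at some point
  of a small parallelogram at \<open>p\<close>. Both mixed derivatives are continuous at
  \<open>p\<close>, so their values there differ by less than any \<open>e\<close>.\<close>

lemma second_derivative_symmetric_real:
  fixes f :: "'a::real_normed_vector \<Rightarrow> real"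
  assumes f: "smooth_on S f" and p: "p \<in> S"
  shows "frechet_derivative (\<lambda>x. frechet_derivative f (at x) u) (at p) v =
         frechet_derivative (\<lambda>x. frechet_derivative f (at x) v) (at p) u"
proof -
  define F where "F = (\<lambda>u v x. frechet_derivative (\<lambda>x. frechet_derivative f (at x) u) (at x) v)"
  have cont: "isCont (F u v) p" for u v
    using smooth_on_frechet_derivative[OF smooth_on_frechet_derivative[OF f]] p
    unfolding F_def by (metis smooth_on_def Ck_on.simps(1) continuous_on_eq_continuous_at)
  have "\<bar>F u v p - F v u p\<bar> \<le> e" if "0 < e" for e
  proof -
    have near: "\<forall>\<^sub>F x in nhds p. dist (F u v x) (F u v p) < e / 2" for u v
      using cont[of u v] that unfolding isCont_def tendsto_at_iff_tendsto_nhds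
      by (intro tendstoD) simp_all
    have "\<forall>\<^sub>F x in nhds p. x \<in> S \<and> dist (F u v x) (F u v p) < e / 2 \<and> dist (F v u x) (F v u p) < e / 2"
      using f p by (intro eventually_conj near) (simp add: smooth_on_def eventually_nhds_in_open)
    then obtain d where d: "0 < d" "\<And>x. dist x p < d \<Longrightarrow>
       x \<in> S \<and> dist (F u v x) (F u v p) < e / 2 \<and> dist (F v u x) (F v u p) < e / 2"
      unfolding eventually_nhds_metric by blast
    \<comment> \<open>The summand 1 keeps \<open>N\<close> positive when \<open>u\<close> and
      \<open>v\<close> vanish; with \<open>h = d / N / 2\<close> the whole parallelogram stays
      within distance \<open>d\<close> of \<open>p\<close>.\<close>
    define N where "N = norm u + norm v + 1"
    define h where "h = d / N / 2"
    have N: "0 < N" by (simp add: N_def add_nonneg_pos)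
    have h: "0 < h" using d(1) N by (simp add: h_def)
    have "h * (norm u + norm v) \<le> h * N"
      using h by (intro mult_left_mono) (simp_all add: N_def)
    also have "\<dots> < d" using d(1) N by (simp add: h_def)
    finally have hd: "h * (norm u + norm v) < d" .
    have near: "dist (p + \<xi> *\<^sub>R u + \<eta> *\<^sub>R v) p < d"
      if "0 \<le> \<xi>" "\<xi> \<le> h" "0 \<le> \<eta>" "\<eta> \<le> h" for \<xi> \<eta>
    proof -
      have "dist (p + \<xi> *\<^sub>R u + \<eta> *\<^sub>R v) p \<le> \<xi> * norm u + \<eta> * norm v"
        using norm_triangle_ineq[of "\<xi> *\<^sub>R u" "\<eta> *\<^sub>R v"] that by (simp add: dist_norm)
      also have "\<dots> \<le> h * norm u + h * norm v"
        using that by (intro add_mono mult_right_mono) auto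
      finally show ?thesis using hd by (simp add: algebra_simps)
    qed
    obtain \<xi> \<eta> where 1: "0 < \<xi>" "\<xi> < h" "0 < \<eta>" "\<eta> < h"
      "f (p + h *\<^sub>R u + h *\<^sub>R v) - f (p + h *\<^sub>R u) - f (p + h *\<^sub>R v) + f p =
       h * h * F u v (p + \<xi> *\<^sub>R u + \<eta> *\<^sub>R v)"
      unfolding F_def by (rule second_difference[OF f h, of p u v]) (use near d in auto)
    obtain \<xi>' \<eta>' where 2: "0 < \<xi>'" "\<xi>' < h" "0 < \<eta>'" "\<eta>' < h"
      "f (p + h *\<^sub>R v + h *\<^sub>R u) - f (p + h *\<^sub>R v) - f (p + h *\<^sub>R u) + f p =
       h * h * F v u (p + \<xi>' *\<^sub>R v + \<eta>' *\<^sub>R u)"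
      unfolding F_def
      by (rule second_difference[OF f h, of p v u])
        (use near d in \<open>auto simp: add.assoc add.commute[of "_ *\<^sub>R v"]\<close>)
    have "h * h * F u v (p + \<xi> *\<^sub>R u + \<eta> *\<^sub>R v) = h * h * F v u (p + \<eta>' *\<^sub>R u + \<xi>' *\<^sub>R v)"
      using 1(5) 2(5) by (simp add: algebra_simps)
    then have "F u v (p + \<xi> *\<^sub>R u + \<eta> *\<^sub>R v) = F v u (p + \<eta>' *\<^sub>R u + \<xi>' *\<^sub>R v)"
      using h by simp
    moreover have "dist (F u v (p + \<xi> *\<^sub>R u + \<eta> *\<^sub>R v)) (F u v p) < e / 2"
      using d(2) near 1 by simp
    moreover have "dist (F v u (p + \<eta>' *\<^sub>R u + \<xi>' *\<^sub>R v)) (F v u p) < e / 2"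
      using d(2) near 2 by simp
    ultimately show ?thesis unfolding dist_real_def by linarith
  qed
  then have "\<bar>F u v p - F v u p\<bar> \<le> 0" by (rule field_le_epsilon) simp
  then show ?thesis by (simp add: F_def)
qed

lemma second_derivative_symmetric:
  fixes f :: "'a::real_normed_vector \<Rightarrow> 'b::euclidean_space"
  assumes f: "smooth_on S f" and p: "p \<in> S"
  shows "frechet_derivative (\<lambda>x. frechet_derivative f (at x) u) (at p) v =
         frechet_derivative (\<lambda>x. frechet_derivative f (at x) v) (at p) u"
proof (rule euclidean_eqI)
  fix i :: 'b assume "i \<in> Basis"
  have S: "open S" using f by (simp add: smooth_on_def)
  have D: "frechet_derivative (\<lambda>x. k x \<bullet> i) (at x) w = frechet_derivative k (at x) w \<bullet> i"
    if "smooth_on S k" "x \<in> S" for k :: "'a \<Rightarrow> 'b" and x w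
    by (rule fun_cong[OF frechet_derivativeI, of _ "\<lambda>w. frechet_derivative k (at x) w \<bullet> i"])
      (use smooth_on_has_derivative[OF that] in \<open>auto intro!: has_derivative_inner_left\<close>)
  have fi: "smooth_on S (\<lambda>x. f x \<bullet> i)"
    using f Ck_on_bounded_linear[OF _ bounded_linear_inner_left] unfolding smooth_on_def by blast
  have "frechet_derivative (\<lambda>x. frechet_derivative f (at x) u) (at p) v \<bullet> i =
    frechet_derivative (\<lambda>x. frechet_derivative (\<lambda>x. f x \<bullet> i) (at x) u) (at p) v" for u v
  proof -
    have "frechet_derivative (\<lambda>x. frechet_derivative f (at x) u) (at p) v \<bullet> i =
      frechet_derivative (\<lambda>x. frechet_derivative f (at x) u \<bullet> i) (at p) v"
      using D[OF smooth_on_frechet_derivative[OF f] p] by simp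
    also have "frechet_derivative (\<lambda>x. frechet_derivative f (at x) u \<bullet> i) (at p) =
      frechet_derivative (\<lambda>x. frechet_derivative (\<lambda>x. f x \<bullet> i) (at x) u) (at p)"
    proof (rule frechet_derivative_transform_within_open[OF _ S p])
      show "(\<lambda>x. frechet_derivative f (at x) u \<bullet> i) differentiable at p"
        using has_derivative_inner_left[OF smooth_on_has_derivative[OF
              smooth_on_frechet_derivative[OF f] p]]
        by (auto simp: differentiable_def)
    qed (simp add: D[OF f])
    finally show ?thesis .
  qed
  then show "frechet_derivative (\<lambda>x. frechet_derivative f (at x) u) (at p) v \<bullet> i =
         frechet_derivative (\<lambda>x. frechet_derivative f (at x) v) (at p) u \<bullet> i"
    using second_derivative_symmetric_real[OF fi p] by simp
qed

section \<open>Differentiation along curves, one-sided at the ends of an interval\<close>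

text \<open>Expanding both arguments in a basis turns the claim into the product rule for real
  functions. Differentiability of \<open>h\<close> in the point is thus needed only for fixed
  vectors, which is how smoothness of a metric becomes available.\<close>

lemma bilinear_family_has_derivative:
  fixes h :: "'x::real_normed_vector \<Rightarrow> 'v::euclidean_space \<Rightarrow> 'v \<Rightarrow> real"
  assumes U: "open U" "y t \<in> U" and bil: "\<And>x. x \<in> U \<Longrightarrow> bilinear (h x)"
    and h: "\<And>u v. (\<lambda>x. h x u v) differentiable (at (y t))"
    and y: "(y has_vector_derivative y') (at t within I)"
    and u: "(u has_vector_derivative u') (at t within I)"
    and v: "(v has_vector_derivative v') (at t within I)"
    and t: "t \<in> I"
  shows "((\<lambda>t. h (y t) (u t) (v t)) has_real_derivative
    frechet_derivative (\<lambda>x. h x (u t) (v t)) (at (y t)) y' + h (y t) u' (v t) + h (y t) (u t) v')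
    (at t within I)"
proof -
  define H where "H = (\<lambda>i j. frechet_derivative (\<lambda>x. h x i j) (at (y t)))"
  have H: "((\<lambda>x. h x i j) has_derivative H i j) (at (y t))" for i j
    unfolding H_def using h by (simp add: frechet_derivative_works[symmetric])
  have expand: "h x p q = (\<Sum>i\<in>Basis. \<Sum>j\<in>Basis. (p \<bullet> i) * (q \<bullet> j) * h x i j)" if "x \<in> U" for x p q
  proof -
    have "h x p q = h x (\<Sum>i\<in>Basis. (p \<bullet> i) *\<^sub>R i) (\<Sum>j\<in>Basis. (q \<bullet> j) *\<^sub>R j)"
      by (simp add: euclidean_representation)
    also have "\<dots> = (\<Sum>i\<in>Basis. \<Sum>j\<in>Basis. (p \<bullet> i) * (q \<bullet> j) * h x i j)"
      by (simp add: bilinear_sum[OF bil[OF that]] sum.cartesian_product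
          bilinear_lmul[OF bil[OF that]] bilinear_rmul[OF bil[OF that]] mult_ac)
    finally show ?thesis .
  qed
  have "((\<lambda>x. \<Sum>i\<in>Basis. \<Sum>j\<in>Basis. (u t \<bullet> i) * (v t \<bullet> j) * h x i j) has_derivative
      (\<lambda>z. \<Sum>i\<in>Basis. \<Sum>j\<in>Basis. (u t \<bullet> i) * (v t \<bullet> j) * H i j z)) (at (y t))"
    by (intro has_derivative_sum has_derivative_mult_right H)
  then have "((\<lambda>x. h x (u t) (v t)) has_derivative
      (\<lambda>z. \<Sum>i\<in>Basis. \<Sum>j\<in>Basis. (u t \<bullet> i) * (v t \<bullet> j) * H i j z)) (at (y t))"
    by (rule has_derivative_transform_within_open[OF _ U]) (rule expand[symmetric])
  \<comment> \<open>With the vectors frozen at time \<open>t\<close>, the derivative in the point is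
    the sum in which only the coefficients are differentiated; this identifies the first summand of
    the product rule.\<close>
  note Hsum = frechet_derivativeI[OF this]
  have hy: "((\<lambda>t. h (y t) i j) has_real_derivative H i j y') (at t within I)" for i j
  proof -
    have "(\<lambda>x. H i j (x *\<^sub>R y')) = (*) (H i j y')"
      using linear_scale[OF has_derivative_linear[OF H]] by (simp add: fun_eq_iff)
    then show ?thesis
      using has_derivative_compose[OF y[unfolded has_vector_derivative_def] H[of i j]]
      by (simp add: has_field_derivative_def)
  qed
  have ui: "((\<lambda>t. u t \<bullet> i) has_real_derivative u' \<bullet> i) (at t within I)"
    and vi: "((\<lambda>t. v t \<bullet> i) has_real_derivative v' \<bullet> i) (at t within I)" for i
    using bounded_linear.has_vector_derivative[OF bounded_linear_inner_left[of i] u]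
      bounded_linear.has_vector_derivative[OF bounded_linear_inner_left[of i] v]
    by (simp_all add: has_real_derivative_iff_has_vector_derivative)
  have "((\<lambda>t. \<Sum>i\<in>Basis. \<Sum>j\<in>Basis. (u t \<bullet> i) * (v t \<bullet> j) * h (y t) i j) has_real_derivative
    (\<Sum>i\<in>Basis. \<Sum>j\<in>Basis. (u t \<bullet> i) * (v t \<bullet> j) * H i j y') +
    (\<Sum>i\<in>Basis. \<Sum>j\<in>Basis. (u' \<bullet> i) * (v t \<bullet> j) * h (y t) i j) +
    (\<Sum>i\<in>Basis. \<Sum>j\<in>Basis. (u t \<bullet> i) * (v' \<bullet> j) * h (y t) i j)) (at t within I)"
  proof -
    have "((\<lambda>t. (u t \<bullet> i) * (v t \<bullet> j) * h (y t) i j) has_real_derivative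
      (u t \<bullet> i) * (v t \<bullet> j) * H i j y' + (u' \<bullet> i) * (v t \<bullet> j) * h (y t) i j +
      (u t \<bullet> i) * (v' \<bullet> j) * h (y t) i j) (at t within I)" for i j
      by (rule DERIV_cong[OF DERIV_mult[OF DERIV_mult[OF ui vi] hy]]) (simp add: algebra_simps)
    then have "((\<lambda>t. \<Sum>i\<in>Basis. \<Sum>j\<in>Basis. (u t \<bullet> i) * (v t \<bullet> j) * h (y t) i j) has_real_derivative
      (\<Sum>i\<in>Basis. \<Sum>j\<in>Basis. (u t \<bullet> i) * (v t \<bullet> j) * H i j y' +
        (u' \<bullet> i) * (v t \<bullet> j) * h (y t) i j + (u t \<bullet> i) * (v' \<bullet> j) * h (y t) i j)) (at t within I)"
      by (intro DERIV_sum)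
    then show ?thesis by (simp add: sum.distrib)
  qed
  then have D: "((\<lambda>t. \<Sum>i\<in>Basis. \<Sum>j\<in>Basis. (u t \<bullet> i) * (v t \<bullet> j) * h (y t) i j) has_real_derivative
    frechet_derivative (\<lambda>x. h x (u t) (v t)) (at (y t)) y' + h (y t) u' (v t) + h (y t) (u t) v')
    (at t within I)"
    by (simp only: Hsum flip: expand[OF U(2), of u' "v t"] expand[OF U(2), of "u t" v'])
  \<comment> \<open>Bilinearity, and with it the expansion, is known on \<open>U\<close> only; by
    continuity \<open>y\<close> stays in \<open>U\<close> near \<open>t\<close>.\<close>
  have "continuous (at t within I) y"
    using y by (rule has_vector_derivative_continuous)
  then have "\<forall>\<^sub>F s in at t within I. y s \<in> U"
    using U by (simp add: continuous_within topological_tendstoD)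
  then have "\<forall>\<^sub>F s in at t within I. (\<Sum>i\<in>Basis. \<Sum>j\<in>Basis. (u s \<bullet> i) * (v s \<bullet> j) * h (y s) i j) =
      h (y s) (u s) (v s)"
    by eventually_elim (rule expand[symmetric])
  then show ?thesis
    using D t unfolding has_field_derivative_def
    by (elim has_derivative_transform_eventually) (simp_all only: expand[OF U(2), of "u t" "v t"])
qed

lemma frechet_derivative_direction:
  assumes "smooth_on W f" "k t \<in> W" "(k has_vector_derivative w) (at t within I)"
  shows "((\<lambda>t. f (k t)) has_vector_derivative frechet_derivative f (at (k t)) w) (at t within I)"
proof -
  note f = smooth_on_has_derivative[OF assms(1,2)]
  have "(\<lambda>x. frechet_derivative f (at (k t)) (x *\<^sub>R w)) = (\<lambda>x. x *\<^sub>R frechet_derivative f (at (k t)) w)"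
    using linear_scale[OF has_derivative_linear[OF f]] by (simp add: fun_eq_iff)
  then show ?thesis
    using has_derivative_compose[OF assms(3)[unfolded has_vector_derivative_def] f]
    by (simp add: has_vector_derivative_def)
qed

text \<open>Intended for a coordinate line \<open>j\<close> in the parameter plane: local formulas
  hold only for parameters in \<open>I\<close> whose image lies in the open set \<open>W\<close>,
  and this suffices to transfer the derivative.\<close>

lemma has_vector_derivative_near:
  fixes f h :: "real \<Rightarrow> 'b::real_normed_vector"
  assumes "(f has_vector_derivative D) (at t within I)" "open W" "j t \<in> W" "isCont j t" "t \<in> I"
    and "\<And>u. u \<in> I \<Longrightarrow> j u \<in> W \<Longrightarrow> f u = h u"
  shows "(h has_vector_derivative D) (at t within I)"
proof -
  have "(j \<longlongrightarrow> j t) (at t within I)"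
    using assms(4) unfolding isCont_def by (rule tendsto_within_subset) simp
  from topological_tendstoD[OF this assms(2,3)]
  have "\<forall>\<^sub>F u in at t within I. j u \<in> W" .
  moreover have "\<forall>\<^sub>F u in at t within I. u \<in> I" by (simp add: eventually_at_filter)
  ultimately have "\<forall>\<^sub>F u in at t within I. f u = h u"
    by eventually_elim (rule assms(6))
  then show ?thesis
    using assms unfolding has_vector_derivative_def
    by (elim has_derivative_transform_eventually) auto
qed

section \<open>Charts\<close>

locale smooth_manifold =
  fixes A :: "('a::topological_space, 'm::finite) chart set"
  assumes atlas: "smooth_atlas A"
begin

lemma open_chart_dom: "c \<in> A \<Longrightarrow> open (chart_dom c)"
  and chart_homeomorphism:
    "c \<in> A \<Longrightarrow> homeomorphism (chart_dom c) (coord c ` chart_dom c) (coord c) (param c)"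
  and smooth_transition: "c \<in> A \<Longrightarrow> d \<in> A \<Longrightarrow>
    smooth_on (coord c ` (chart_dom c \<inter> chart_dom d)) (transition c d)"
  using atlas by (simp_all add: smooth_atlas_def)

lemma param_coord: "c \<in> A \<Longrightarrow> p \<in> chart_dom c \<Longrightarrow> param c (coord c p) = p"
  using chart_homeomorphism by (auto simp: homeomorphism_def)

lemma chart_at_mem [simp]: "chart_at A p \<in> A" "p \<in> chart_dom (chart_at A p)"
proof -
  have "\<exists>c. c \<in> A \<and> p \<in> chart_dom c"
    using atlas unfolding smooth_atlas_def by blast
  then have "chart_at A p \<in> A \<and> p \<in> chart_dom (chart_at A p)"
    unfolding chart_at_def by (rule someI_ex)
  then show "chart_at A p \<in> A" "p \<in> chart_dom (chart_at A p)" by simp_all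
qed

lemma transition_coord: "c \<in> A \<Longrightarrow> p \<in> chart_dom c \<Longrightarrow> transition c d (coord c p) = coord d p"
  by (simp add: transition_def param_coord)

lemma transition_has_derivative:
  assumes "c \<in> A" "d \<in> A" "p \<in> chart_dom c" "p \<in> chart_dom d"
  shows "(transition c d has_derivative frechet_derivative (transition c d) (at (coord c p))) (at (coord c p))"
  using assms by (intro smooth_on_has_derivative[OF smooth_transition]) auto

text \<open>The chain rule, since passing from \<open>c\<close> to \<open>e\<close> through
  \<open>d\<close> agrees with \<open>transition c e\<close> on an open neighbourhood. This cocycle
  identity removes the arbitrary charts \<open>chart_at A p\<close> from later formulas.\<close>

lemma transition_chain:
  assumes "c \<in> A" "d \<in> A" "e \<in> A" "p \<in> chart_dom c" "p \<in> chart_dom d" "p \<in> chart_dom e"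
  shows "frechet_derivative (transition d e) (at (coord d p))
      (frechet_derivative (transition c d) (at (coord c p)) v) =
    frechet_derivative (transition c e) (at (coord c p)) v"
proof -
  have "(transition d e \<circ> transition c d has_derivative
      frechet_derivative (transition d e) (at (coord d p)) \<circ>
      frechet_derivative (transition c d) (at (coord c p))) (at (coord c p))"
    using transition_has_derivative[of d e p] transition_has_derivative[of c d p] assms
    by (intro diff_chain_at) (simp_all add: transition_coord)
  then have "(transition c e has_derivative
      frechet_derivative (transition d e) (at (coord d p)) \<circ>
      frechet_derivative (transition c d) (at (coord c p))) (at (coord c p))"
  proof (rule has_derivative_transform_within_open)
    show "open (coord c ` (chart_dom c \<inter> chart_dom d))"
      using smooth_transition[of c d] assms by (simp add: smooth_on_def)
    show "(transition d e \<circ> transition c d) x = transition c e x"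
      if "x \<in> coord c ` (chart_dom c \<inter> chart_dom d)" for x
      using that assms by (auto simp: transition_coord)
  qed (use assms in auto)
  then show ?thesis by (simp add: frechet_derivativeI)
qed

lemma transition_self:
  assumes "c \<in> A" "p \<in> chart_dom c"
  shows "frechet_derivative (transition c c) (at (coord c p)) v = v"
proof -
  have "(transition c c has_derivative (\<lambda>v. v)) (at (coord c p))"
    by (rule has_derivative_transform_within_open[of "\<lambda>x. x" _ _ _ "coord c ` chart_dom c"])
      (use atlas assms in \<open>auto simp: transition_coord smooth_atlas_def\<close>)
  then show ?thesis by (simp add: frechet_derivativeI)
qed

lemma components_const_field:
  assumes "c \<in> A" "d \<in> A" "p \<in> chart_dom c" "p \<in> chart_dom d"
  shows "components A d p (const_field A c v p) =
    frechet_derivative (transition c d) (at (coord c p)) v"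
  using assms by (simp add: components_def const_field_def transition_chain)

lemma const_field_chart_at: "const_field A (chart_at A p) v p = v"
  by (simp add: const_field_def transition_self)

lemma linear_const_field:
  assumes "c \<in> A" "p \<in> chart_dom c"
  shows "linear (\<lambda>v. const_field A c v p)"
  using has_derivative_linear[OF transition_has_derivative[of c "chart_at A p" p]] assms
  by (simp add: const_field_def)

text \<open>By the cocycle identity the chart chosen at the point drops out, leaving an expression
  that is visibly smooth in the coordinates.\<close>

lemma field_rep_const_field:
  assumes "c \<in> A" "d \<in> A" "p \<in> chart_dom c" "p \<in> chart_dom d"
  shows "field_rep A d (const_field A c v) (coord d p) =
    frechet_derivative (transition c d) (at (transition d c (coord d p))) v"
  using assms by (simp add: field_rep_def param_coord components_const_field transition_coord)

lemma smooth_const_field: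
  assumes "c \<in> A"
  shows "smooth_field A (chart_dom c) (const_field A c v)"
  unfolding smooth_field_def
proof (intro conjI ballI open_chart_dom assms)
  fix d assume d: "d \<in> A"
  have "smooth_on (coord d ` (chart_dom d \<inter> chart_dom c))
      ((\<lambda>x. frechet_derivative (transition c d) (at x) v) \<circ> transition d c)"
    by (rule smooth_on_compose[OF smooth_on_frechet_derivative[OF smooth_transition] smooth_transition])
      (use assms d in \<open>auto simp: transition_coord\<close>)
  then show "smooth_on (coord d ` (chart_dom c \<inter> chart_dom d)) (field_rep A d (const_field A c v))"
    unfolding Int_commute[of "chart_dom c"]
    by (rule smooth_on_cong) (use assms d in \<open>auto simp: field_rep_const_field\<close>)
qed

text \<open>Coordinate fields commute, so the bracket drops out of the torsion.\<close>

lemma torsion_eq: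
  "torsion A nab p v w = nab p v (const_field A (chart_at A p) w) - nab p w (const_field A (chart_at A p) v)"
proof -
  define c where "c = chart_at A p"
  have c: "c \<in> A" "p \<in> chart_dom c" by (simp_all add: c_def)
  have "frechet_derivative (field_rep A c (const_field A c u)) (at (coord c p)) = (\<lambda>_. 0)" for u
  proof (rule frechet_derivativeI, rule has_derivative_transform_within_open)
    show "((\<lambda>x. u) has_derivative (\<lambda>_. 0)) (at (coord c p))" by simp
    show "open (coord c ` chart_dom c)" using atlas c by (simp add: smooth_atlas_def)
    show "u = field_rep A c (const_field A c u) x" if "x \<in> coord c ` chart_dom c" for x
      using that c by (auto simp: field_rep_const_field transition_coord transition_self)
  qed (use c in auto)
  then show ?thesis
    by (simp add: torsion_def torsion_fields_def lie_bracket_def Let_def const_field_chart_at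
        flip: c_def) (simp add: c_def const_field_chart_at)
qed

text \<open>Here \<open>k\<close> is a local extension of the curve beyond \<open>I\<close>. A
  two-sided derivative of \<open>k\<close> in any chart \<open>c\<close> determines the velocity of
  the curve, even at an end of \<open>I\<close>; nontriviality of the filter makes the derivative
  within \<open>I\<close> unique.\<close>

lemma velocity_eq:
  assumes c: "c \<in> A" "\<gamma> t \<in> chart_dom c" and t: "t \<in> I" "at t within I \<noteq> bot"
    and k: "isCont k t" "\<forall>\<^sub>F u in at t within I. k u = \<gamma> u" "k t = \<gamma> t"
    and w: "((\<lambda>u. coord c (k u)) has_vector_derivative w) (at t)"
  shows "velocity A I \<gamma> t = const_field A c w (\<gamma> t)"
proof -
  define d where "d = chart_at A (\<gamma> t)"
  have d: "d \<in> A" "\<gamma> t \<in> chart_dom d" by (simp_all add: d_def)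
  have ev: "\<forall>\<^sub>F u in at t. k u \<in> chart_dom c"
    using topological_tendstoD[OF k(1)[unfolded isCont_def] open_chart_dom[OF c(1)]] c k(3) by simp
  have "((\<lambda>u. transition c d (coord c (k u))) has_vector_derivative
      frechet_derivative (transition c d) (at (coord c (k t))) w) (at t)"
    by (rule frechet_derivative_direction[OF smooth_transition[OF c(1) d(1)] _ w]) (use c d k in auto)
  then have "((\<lambda>u. coord d (k u)) has_vector_derivative
      frechet_derivative (transition c d) (at (coord c (k t))) w) (at t)"
    unfolding has_vector_derivative_def
    by (rule has_derivative_transform_eventually)
      (use ev c k in \<open>auto elim!: eventually_mono simp: transition_coord\<close>)
  then have "((\<lambda>u. coord d (k u)) has_vector_derivative
      frechet_derivative (transition c d) (at (coord c (k t))) w) (at t within I)"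
    by (rule has_vector_derivative_at_within)
  then have "((coord d \<circ> \<gamma>) has_vector_derivative
      frechet_derivative (transition c d) (at (coord c (k t))) w) (at t within I)"
    unfolding has_vector_derivative_def
    by (rule has_derivative_transform_eventually)
      (use k t in \<open>auto elim!: eventually_mono\<close>)
  then show ?thesis
    unfolding velocity_def d_def[symmetric] using t k
    by (simp add: vector_derivative_within const_field_def d_def)
qed

text \<open>The map \<open>f\<close> is the coordinate expression of a smooth local extension of the
  family. The interval \<open>I\<close> is left free so that velocities within different intervals
  can be compared: the right-hand sides do not depend on it.\<close>

lemma local_representation:
  fixes \<Gamma> :: "real \<Rightarrow> real \<Rightarrow> 'a"
  assumes "smooth_map_on A (K \<times> L) (\<lambda>(t, s). \<Gamma> s t)" "t0 \<in> K" "s0 \<in> L"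
  defines "c \<equiv> chart_at A (\<Gamma> s0 t0)"
  obtains W f where "open W" "(t0, s0) \<in> W" "smooth_on W f"
    "\<And>t s. t \<in> K \<Longrightarrow> s \<in> L \<Longrightarrow> (t, s) \<in> W \<Longrightarrow> \<Gamma> s t \<in> chart_dom c"
    "\<And>t s. t \<in> K \<Longrightarrow> s \<in> L \<Longrightarrow> (t, s) \<in> W \<Longrightarrow> coord c (\<Gamma> s t) = f (t, s)"
    "\<And>t s I. I \<subseteq> K \<Longrightarrow> t \<in> I \<Longrightarrow> s \<in> L \<Longrightarrow> (t, s) \<in> W \<Longrightarrow> at t within I \<noteq> bot \<Longrightarrow>
      velocity A I (\<Gamma> s) t = const_field A c (frechet_derivative f (at (t, s)) (1, 0)) (\<Gamma> s t)"
    "\<And>t s I. I \<subseteq> L \<Longrightarrow> t \<in> K \<Longrightarrow> s \<in> I \<Longrightarrow> (t, s) \<in> W \<Longrightarrow> at s within I \<noteq> bot \<Longrightarrow>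
      velocity A I (\<lambda>s. \<Gamma> s t) s = const_field A c (frechet_derivative f (at (t, s)) (0, 1)) (\<Gamma> s t)"
proof -
  have c: "c \<in> A" "\<Gamma> s0 t0 \<in> chart_dom c" by (simp_all add: c_def)
  obtain V F where V: "open V" "(t0, s0) \<in> V" "continuous_on V F"
    and F: "\<And>t s. t \<in> K \<Longrightarrow> s \<in> L \<Longrightarrow> (t, s) \<in> V \<Longrightarrow> F (t, s) = \<Gamma> s t"
    and smF: "smooth_on (V \<inter> F -` chart_dom c) (coord c \<circ> F)"
    using assms(1)[unfolded smooth_map_on_def, rule_format, of "(t0, s0)"] assms(2,3) c by force
  define W where "W = V \<inter> F -` chart_dom c"
  define f where "f = coord c \<circ> F"
  have W: "open W" "(t0, s0) \<in> W"
    using smF V F assms(2,3) c by (auto simp: W_def smooth_on_def)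
  have f: "smooth_on W f" using smF by (simp add: W_def f_def)
  have FW: "F x \<in> chart_dom c" "isCont F x" if "x \<in> W" for x
    using that V by (auto simp: W_def continuous_on_eq_continuous_at)
  have WV: "W \<subseteq> V" by (auto simp: W_def)
  \<comment> \<open>With \<open>j\<close> running along either coordinate line of the parameter
    plane, this one fact yields both velocity formulas.\<close>
  have vel: "velocity A I \<beta> u = const_field A c (frechet_derivative f (at (j u)) w) (\<beta> u)"
    if "u \<in> I" "at u within I \<noteq> bot" "j u \<in> W" "(j has_vector_derivative w) (at u)"
      "\<And>z. z \<in> I \<Longrightarrow> j z \<in> W \<Longrightarrow> F (j z) = \<beta> z" for I \<beta> u j w
  proof (rule velocity_eq[where k = "\<lambda>z. F (j z)"])
    have j: "isCont j u" using that(4) has_vector_derivative_continuous by blast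
    then show "isCont (\<lambda>z. F (j z)) u" using FW(2)[OF that(3)] by (rule isCont_o2)
    have "\<forall>\<^sub>F z in at u within I. j z \<in> W"
      using j W(1) that(3) by (auto simp: isCont_def intro: filter_leD[OF at_le[of I UNIV u]] topological_tendstoD)
    moreover have "\<forall>\<^sub>F z in at u within I. z \<in> I" by (simp add: eventually_at_filter)
    ultimately show "\<forall>\<^sub>F z in at u within I. F (j z) = \<beta> z"
      by eventually_elim (rule that(5))
    show "((\<lambda>z. coord c (F (j z))) has_vector_derivative frechet_derivative f (at (j u)) w) (at u)"
      using frechet_derivative_direction[OF f that(3,4)] by (simp add: f_def)
  qed (use that c FW in \<open>auto simp flip: that(5)\<close>)
  show thesis
  proof (rule that[OF W f])
    show "\<Gamma> s t \<in> chart_dom c" "coord c (\<Gamma> s t) = f (t, s)"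
      if "t \<in> K" "s \<in> L" "(t, s) \<in> W" for t s
      using FW(1)[OF that(3)] F[OF that(1,2)] that(3) WV by (auto simp: f_def)
    show "velocity A I (\<Gamma> s) t = const_field A c (frechet_derivative f (at (t, s)) (1, 0)) (\<Gamma> s t)"
      if "I \<subseteq> K" "t \<in> I" "s \<in> L" "(t, s) \<in> W" "at t within I \<noteq> bot" for t s I
      by (rule vel) (use that F WV in \<open>auto intro!: derivative_eq_intros\<close>)
    show "velocity A I (\<lambda>s. \<Gamma> s t) s = const_field A c (frechet_derivative f (at (t, s)) (0, 1)) (\<Gamma> s t)"
      if "I \<subseteq> L" "t \<in> K" "s \<in> I" "(t, s) \<in> W" "at s within I \<noteq> bot" for t s I
      by (rule vel) (use that F WV in \<open>auto intro!: derivative_eq_intros\<close>)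
  qed
qed

end

section \<open>Curves in a Riemannian manifold\<close>

text \<open>The metric coefficients in the coordinate frame of \<open>c\<close>. Unlike
  \<open>g p v w\<close> for fixed \<open>v\<close> and \<open>w\<close>, they vary smoothly with
  the point.\<close>

definition chart_metric ::
  "('a, 'm::finite) chart set \<Rightarrow> ('a, 'm) metric \<Rightarrow> ('a, 'm) chart \<Rightarrow> real^'m \<Rightarrow> real^'m \<Rightarrow> real^'m \<Rightarrow> real" where
  "chart_metric A g c x u v =
    (let p = param c x in g p (const_field A c u p) (const_field A c v p))"

locale smooth_riemannian_manifold = smooth_manifold A
  for A :: "('a::topological_space, 'm::finite) chart set" +
  fixes g :: "('a, 'm) metric"
  assumes metric: "riemannian_metric A g"
begin

lemma bilinear_metric: "bilinear (g p)"
  and metric_commute: "g p v w = g p w v"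
  using metric unfolding riemannian_metric_def by blast+

lemma chart_metric_coord:
  "c \<in> A \<Longrightarrow> p \<in> chart_dom c \<Longrightarrow>
    chart_metric A g c (coord c p) u v = g p (const_field A c u p) (const_field A c v p)"
  by (simp add: chart_metric_def param_coord)

lemma bilinear_chart_metric:
  assumes "c \<in> A" "x \<in> coord c ` chart_dom c"
  shows "bilinear (chart_metric A g c x)"
proof -
  obtain p where p: "p \<in> chart_dom c" "x = coord c p" using assms by blast
  have "linear (\<lambda>v. g p (const_field A c u p) (const_field A c v p))"
    "linear (\<lambda>v. g p (const_field A c v p) (const_field A c u p))" for u
    using linear_compose[OF linear_const_field[OF assms(1) p(1)]] bilinear_metric[of p]
    by (auto simp: bilinear_def o_def)
  then show ?thesis
    by (simp add: bilinear_def p chart_metric_coord assms)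
qed

lemma chart_metric_differentiable:
  assumes "c \<in> A" "x \<in> coord c ` chart_dom c"
  shows "(\<lambda>x. chart_metric A g c x u v) differentiable (at x)"
proof -
  have "smooth_fun A (chart_dom c) (\<lambda>p. g p (const_field A c u p) (const_field A c v p))"
    using metric smooth_const_field[OF assms(1)] unfolding riemannian_metric_def by blast
  then have "smooth_on (coord c ` chart_dom c)
      ((\<lambda>p. g p (const_field A c u p) (const_field A c v p)) \<circ> param c)"
    using assms(1) unfolding smooth_fun_def by (metis Int_absorb)
  then have "smooth_on (coord c ` chart_dom c) (\<lambda>x. chart_metric A g c x u v)"
    by (simp add: o_def chart_metric_def Let_def)
  from smooth_on_has_derivative[OF this assms(2)] show ?thesis
    unfolding differentiable_def by blast
qed

lemma chart_metric_has_derivative: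
  assumes "c \<in> A" "y t \<in> coord c ` chart_dom c" "t \<in> I"
    and "(y has_vector_derivative y') (at t within I)"
    and "(u has_vector_derivative u') (at t within I)"
    and "(v has_vector_derivative v') (at t within I)"
  shows "((\<lambda>t. chart_metric A g c (y t) (u t) (v t)) has_real_derivative
    frechet_derivative (\<lambda>x. chart_metric A g c x (u t) (v t)) (at (y t)) y' +
    chart_metric A g c (y t) u' (v t) + chart_metric A g c (y t) (u t) v') (at t within I)"
proof (rule bilinear_family_has_derivative[where U = "coord c ` chart_dom c"])
  show "open (coord c ` chart_dom c)" using atlas assms(1) by (simp add: smooth_atlas_def)
qed (use assms bilinear_chart_metric chart_metric_differentiable in auto)

lemma chart_metric_along:
  assumes "c \<in> A" "smooth_on W f" "smooth_on W u" "smooth_on W v"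
    and "j t \<in> W" "f (j t) \<in> coord c ` chart_dom c" "t \<in> I" "(j has_vector_derivative w) (at t within I)"
  shows "((\<lambda>t. chart_metric A g c (f (j t)) (u (j t)) (v (j t))) has_real_derivative
    frechet_derivative (\<lambda>x. chart_metric A g c x (u (j t)) (v (j t))) (at (f (j t)))
      (frechet_derivative f (at (j t)) w) +
    chart_metric A g c (f (j t)) (frechet_derivative u (at (j t)) w) (v (j t)) +
    chart_metric A g c (f (j t)) (u (j t)) (frechet_derivative v (at (j t)) w)) (at t within I)"
  using assms by (intro chart_metric_has_derivative frechet_derivative_direction)

end

section \<open>Lengths in a family parametrized proportionally to arc length\<close>

locale arclength_family = smooth_riemannian_manifold A g
  for A :: "('a::topological_space, 'm::finite) chart set" and g :: "('a, 'm) metric" +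
  fixes \<Gamma> :: "real \<Rightarrow> real \<Rightarrow> 'a" and a b \<epsilon> :: real
  assumes interval: "a < b" "0 < \<epsilon>"
    and smooth: "smooth_map_on A ({a..b} \<times> {-\<epsilon><..<\<epsilon>}) (\<lambda>(t, s). \<Gamma> s t)"
    and arclength: "\<bar>s\<bar> < \<epsilon> \<Longrightarrow> proportional_to_arclength A g a b (\<Gamma> s)"
begin

text \<open>The squared speed, which, unlike the speed, is differentiable also where the velocity
  vanishes.\<close>

definition energy :: "real \<Rightarrow> real \<Rightarrow> real" where
  "energy s t = g (\<Gamma> s t) (velocity A {a..b} (\<Gamma> s) t) (velocity A {a..b} (\<Gamma> s) t)"

lemma at_within_nontrivial:
  "t \<in> {a..b} \<Longrightarrow> at t within {a..b} \<noteq> bot"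
  "s \<in> {-\<epsilon><..<\<epsilon>} \<Longrightarrow> at s within {-\<epsilon><..<\<epsilon>} \<noteq> bot"
proof -
  show "at t within {a..b} \<noteq> bot" if "t \<in> {a..b}"
    using interval that by (simp add: trivial_limit_within)
  show "at s within {-\<epsilon><..<\<epsilon>} \<noteq> bot" if "s \<in> {-\<epsilon><..<\<epsilon>}"
    unfolding at_within_open[OF that open_greaterThanLessThan] by (rule at_neq_bot)
qed

text \<open>\<open>curve_length A g a t\<close> takes velocities within \<open>{a..t}\<close>, hence
  a one-sided derivative at \<open>t\<close>. Smoothness makes it agree with the derivative within
  \<open>{a..b}\<close>; \<open>a < t\<close> excludes the one-point interval.\<close>

lemma velocity_initial_segment:
  assumes "\<bar>s\<bar> < \<epsilon>" "u \<in> {a..t}" "a < t" "t \<le> b"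
  shows "velocity A {a..t} (\<Gamma> s) u = velocity A {a..b} (\<Gamma> s) u"
proof -
  have u: "u \<in> {a..b}" and s: "s \<in> {-\<epsilon><..<\<epsilon>}" using assms by auto
  have nt: "at u within {a..t} \<noteq> bot" using assms by (simp add: trivial_limit_within)
  obtain W f where W: "(u, s) \<in> W"
    and vel: "\<And>t s' I. I \<subseteq> {a..b} \<Longrightarrow> t \<in> I \<Longrightarrow> s' \<in> {-\<epsilon><..<\<epsilon>} \<Longrightarrow> (t, s') \<in> W \<Longrightarrow> at t within I \<noteq> bot \<Longrightarrow>
      velocity A I (\<Gamma> s') t =
        const_field A (chart_at A (\<Gamma> s u)) (frechet_derivative f (at (t, s')) (1, 0)) (\<Gamma> s' t)"
    by (rule local_representation[OF smooth u s]) (rule that; assumption)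
  show ?thesis
    using vel[of "{a..t}" u s, OF _ _ s W nt] vel[OF _ u s W at_within_nontrivial(1)[OF u]] assms
    by simp
qed

text \<open>Continuity is visible only in a chart held fixed near the given time, where the squared
  speed is even differentiable. It is needed to differentiate the arc length.\<close>

lemma continuous_energy:
  assumes s: "\<bar>s\<bar> < \<epsilon>"
  shows "continuous_on {a..b} (energy s)"
  unfolding continuous_on_eq_continuous_within
proof
  fix t assume t: "t \<in> {a..b}"
  define c where "c = chart_at A (\<Gamma> s t)"
  have c: "c \<in> A" by (simp add: c_def)
  have s': "s \<in> {-\<epsilon><..<\<epsilon>}" using s by auto
  obtain W f where W: "open W" "(t, s) \<in> W" and f: "smooth_on W f"
    and dom: "\<And>t s. t \<in> {a..b} \<Longrightarrow> s \<in> {-\<epsilon><..<\<epsilon>} \<Longrightarrow> (t, s) \<in> W \<Longrightarrow> \<Gamma> s t \<in> chart_dom c"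
    and rep: "\<And>t s. t \<in> {a..b} \<Longrightarrow> s \<in> {-\<epsilon><..<\<epsilon>} \<Longrightarrow> (t, s) \<in> W \<Longrightarrow> coord c (\<Gamma> s t) = f (t, s)"
    and vel: "\<And>t s I. I \<subseteq> {a..b} \<Longrightarrow> t \<in> I \<Longrightarrow> s \<in> {-\<epsilon><..<\<epsilon>} \<Longrightarrow> (t, s) \<in> W \<Longrightarrow> at t within I \<noteq> bot \<Longrightarrow>
      velocity A I (\<Gamma> s) t = const_field A c (frechet_derivative f (at (t, s)) (1, 0)) (\<Gamma> s t)"
    by (rule local_representation[OF smooth t s', folded c_def]) (rule that; assumption)
  define f1 where "f1 = (\<lambda>x. frechet_derivative f (at x) (1, 0))"
  have f1: "smooth_on W f1" unfolding f1_def by (rule smooth_on_frechet_derivative[OF f])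
  have j: "((\<lambda>t. (t, s)) has_vector_derivative (1, 0)) (at t within {a..b})"
    by (auto intro!: derivative_eq_intros)
  have x: "f (t, s) \<in> coord c ` chart_dom c"
    using rep[OF t s' W(2)] dom[OF t s' W(2)] by (metis imageI)
  obtain e where
    "((\<lambda>t. chart_metric A g c (f (t, s)) (f1 (t, s)) (f1 (t, s))) has_vector_derivative e) (at t within {a..b})"
    using chart_metric_along[OF c f f1 f1 W(2) x t j]
    by (auto simp: has_real_derivative_iff_has_vector_derivative)
  then have "(energy s has_vector_derivative e) (at t within {a..b})"
  proof (rule has_vector_derivative_near[where W = W and j = "\<lambda>t. (t, s)"])
    fix u assume u: "u \<in> {a..b}" "(u, s) \<in> W"
    show "chart_metric A g c (f (u, s)) (f1 (u, s)) (f1 (u, s)) = energy s u"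
      using dom[OF u(1) s' u(2)] vel[OF _ u(1) s' u(2)] at_within_nontrivial(1)[OF u(1)]
      by (simp add: energy_def f1_def c chart_metric_coord flip: rep[OF u(1) s' u(2)])
  qed (use W t in auto)
  then show "continuous (at t within {a..b}) (energy s)"
    by (rule has_vector_derivative_continuous)
qed

text \<open>For curves parametrized proportionally to arc length no integral has to be differentiated.\<close>

lemma curve_length_eq:
  assumes s: "\<bar>s\<bar> < \<epsilon>" and t: "t \<in> {a..b}"
  shows "curve_length A g a b (\<Gamma> s) = (b - a) * sqrt (energy s t)"
proof -
  have len: "curve_length A g a u (\<Gamma> s) = integral {a..u} (\<lambda>t. sqrt (energy s t))"
    if "u \<in> {a..b}" for u
  proof (cases "a = u")
    case False
    have "speed A g {a..u} (\<Gamma> s) v = sqrt (energy s v)" if "v \<in> {a..u}" for v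
      using velocity_initial_segment[OF s that] \<open>u \<in> {a..b}\<close> False
      by (simp add: speed_def energy_def)
    then show ?thesis unfolding curve_length_def by (intro integral_cong)
  qed (simp add: curve_length_def)
  obtain k where k: "\<And>u. u \<in> {a..b} \<Longrightarrow> curve_length A g a u (\<Gamma> s) = k * (u - a)"
    using arclength[OF s] unfolding proportional_to_arclength_def by blast
  \<comment> \<open>The arc length up to \<open>u\<close> has derivative equal to the speed, while
    by assumption it is linear with slope \<open>k\<close>. So the speed is \<open>k\<close> at
    every time.\<close>
  have "((\<lambda>u. integral {a..u} (\<lambda>t. sqrt (energy s t))) has_vector_derivative sqrt (energy s t))
      (at t within {a..b})"
    by (rule integral_has_vector_derivative[OF _ t]) (intro continuous_intros continuous_energy s)
  moreover have "((\<lambda>u. integral {a..u} (\<lambda>t. sqrt (energy s t))) has_vector_derivative k)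
      (at t within {a..b})"
  proof (rule has_vector_derivative_transform[OF t])
    show "((\<lambda>u. k * (u - a)) has_vector_derivative k) (at t within {a..b})"
      by (auto intro!: derivative_eq_intros simp: has_real_derivative_iff_has_vector_derivative[symmetric])
  qed (use k len in force)
  ultimately have "sqrt (energy s t) = k"
    using at_within_nontrivial(1)[OF t] vector_derivative_unique_within by blast
  then show ?thesis using k[of b] interval by (simp add: mult.commute)
qed

end

section \<open>The first variation for a connection with parallel metric\<close>

definition metric_compatible ::
  "('a::topological_space, 'm::finite) chart set \<Rightarrow> ('a, 'm) metric \<Rightarrow> ('a, 'm) connection \<Rightarrow> bool" where
  "metric_compatible A g nab \<longleftrightarrow>
    (\<forall>U Y Z. smooth_field A U Y \<longrightarrow> smooth_field A U Z \<longrightarrow>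
      (\<forall>p\<in>U. \<forall>v. dir_deriv A p v (\<lambda>q. g q (Y q) (Z q)) =
        g p (nab p v Y) (Z p) + g p (Y p) (nab p v Z)))"

context smooth_riemannian_manifold
begin

text \<open>Parallelism of the metric applied to two coordinate fields. The chart is the one chosen
  at \<open>p\<close>, so these fields take the values \<open>u\<close> and \<open>v\<close>
  there.\<close>

lemma chart_metric_derivative:
  fixes p :: 'a
  assumes compat: "metric_compatible A g nab"
  defines "c \<equiv> chart_at A p"
  shows "frechet_derivative (\<lambda>x. chart_metric A g c x u v) (at (coord c p)) w =
    g p (nab p w (const_field A c u)) v + g p u (nab p w (const_field A c v))"
proof -
  have c: "c \<in> A" "p \<in> chart_dom c" by (simp_all add: c_def)
  have "frechet_derivative (\<lambda>x. chart_metric A g c x u v) (at (coord c p)) w =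
      dir_deriv A p w (\<lambda>q. g q (const_field A c u q) (const_field A c v q))"
    by (simp add: dir_deriv_def o_def chart_metric_def Let_def flip: c_def)
  also have "\<dots> = g p (nab p w (const_field A c u)) (const_field A c v p) +
      g p (const_field A c u p) (nab p w (const_field A c v))"
    using compat smooth_const_field[OF c(1)] c(2) unfolding metric_compatible_def by blast
  finally show ?thesis by (simp add: c_def const_field_chart_at)
qed

end

context arclength_family
begin

text \<open>Both derivatives are computed in the chart chosen at the point. They share the mixed
  derivative \<open>f12\<close> of \<open>f\<close>, so their difference consists of the
  acceleration term and of covariant derivatives of coordinate fields, which form the
  torsion.\<close>

lemma variation_at_point:
  assumes compat: "metric_compatible A g nab"
    and X: "\<And>t. t \<in> {a..b} \<Longrightarrow> X t = velocity A {-\<epsilon><..<\<epsilon>} (\<lambda>s. \<Gamma> s t) 0"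
    and t: "t \<in> {a..b}"
  defines "\<gamma>' \<equiv> velocity A {a..b} (\<Gamma> 0)"
  obtains e where
    "((\<lambda>s. energy s t) has_real_derivative 2 * e) (at 0)"
    "((\<lambda>t. g (\<Gamma> 0 t) (X t) (\<gamma>' t)) has_real_derivative
      e + (g (\<Gamma> 0 t) (X t) (cov_deriv_along A nab {a..b} (\<Gamma> 0) \<gamma>' t) -
        g (\<Gamma> 0 t) (torsion A nab (\<Gamma> 0 t) (X t) (\<gamma>' t)) (\<gamma>' t))) (at t within {a..b})"
proof -
  define p c where "p = \<Gamma> 0 t" and "c = chart_at A p"
  have c: "c \<in> A" "p \<in> chart_dom c" by (simp_all add: c_def)
  have s0: "0 \<in> {-\<epsilon><..<\<epsilon>}" using interval by simp
  obtain W f where W: "open W" "(t, 0) \<in> W" and f: "smooth_on W f"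
    and dom: "\<And>t s. t \<in> {a..b} \<Longrightarrow> s \<in> {-\<epsilon><..<\<epsilon>} \<Longrightarrow> (t, s) \<in> W \<Longrightarrow> \<Gamma> s t \<in> chart_dom c"
    and rep: "\<And>t s. t \<in> {a..b} \<Longrightarrow> s \<in> {-\<epsilon><..<\<epsilon>} \<Longrightarrow> (t, s) \<in> W \<Longrightarrow> coord c (\<Gamma> s t) = f (t, s)"
    and vel1: "\<And>t s I. I \<subseteq> {a..b} \<Longrightarrow> t \<in> I \<Longrightarrow> s \<in> {-\<epsilon><..<\<epsilon>} \<Longrightarrow> (t, s) \<in> W \<Longrightarrow> at t within I \<noteq> bot \<Longrightarrow>
      velocity A I (\<Gamma> s) t = const_field A c (frechet_derivative f (at (t, s)) (1, 0)) (\<Gamma> s t)"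
    and vel2: "\<And>t s I. I \<subseteq> {-\<epsilon><..<\<epsilon>} \<Longrightarrow> t \<in> {a..b} \<Longrightarrow> s \<in> I \<Longrightarrow> (t, s) \<in> W \<Longrightarrow> at s within I \<noteq> bot \<Longrightarrow>
      velocity A I (\<lambda>s. \<Gamma> s t) s = const_field A c (frechet_derivative f (at (t, s)) (0, 1)) (\<Gamma> s t)"
    by (rule local_representation[OF smooth t s0, folded p_def, folded c_def]) (rule that; assumption)
  define f1 f2 where "f1 = (\<lambda>x. frechet_derivative f (at x) (1, 0))"
    and "f2 = (\<lambda>x. frechet_derivative f (at x) (0, 1))"
  have f1: "smooth_on W f1" and f2: "smooth_on W f2"
    unfolding f1_def f2_def by (rule smooth_on_frechet_derivative[OF f])+
  define v x where "v = f1 (t, 0)" and "x = f2 (t, 0)"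
  define f11 f12 where "f11 = frechet_derivative f1 (at (t, 0)) (1, 0)"
    and "f12 = frechet_derivative f1 (at (t, 0)) (0, 1)"
  have f21: "frechet_derivative f2 (at (t, 0)) (1, 0) = f12"
    unfolding f12_def f1_def f2_def by (rule second_derivative_symmetric[OF f W(2)])
  have velocity: "velocity A {a..b} (\<Gamma> s) u = const_field A c (f1 (u, s)) (\<Gamma> s u)"
    if "u \<in> {a..b}" "s \<in> {-\<epsilon><..<\<epsilon>}" "(u, s) \<in> W" for u s
    unfolding f1_def by (rule vel1) (use that at_within_nontrivial in auto)
  have X': "X u = const_field A c (f2 (u, 0)) (\<Gamma> 0 u)" if "u \<in> {a..b}" "(u, 0) \<in> W" for u
    unfolding X[OF that(1)] f2_def by (rule vel2) (use that s0 at_within_nontrivial in auto)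
  have at_t: "\<gamma>' t = v" "X t = x"
    unfolding \<gamma>'_def velocity[OF t s0 W(2)] X'[OF t W(2)] v_def x_def c_def
    by (simp_all add: p_def const_field_chart_at)
  have coord_p: "coord c p = f (t, 0)" unfolding p_def by (rule rep[OF t s0 W(2)])
  have ft: "f (t, 0) \<in> coord c ` chart_dom c" unfolding coord_p[symmetric] using c by (intro imageI)
  have G: "chart_metric A g c (f (t, 0)) y z = g p y z" for y z
    using c by (simp add: chart_metric_coord flip: coord_p) (simp add: c_def const_field_chart_at)
  have DG: "frechet_derivative (\<lambda>q. chart_metric A g c q y z) (at (f (t, 0))) w =
      g p (nab p w (const_field A c y)) z + g p y (nab p w (const_field A c z))" for w y z
    unfolding coord_p[symmetric] c_def by (rule chart_metric_derivative[OF compat])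
  have j1: "((\<lambda>t. (t, 0)) has_vector_derivative (1, 0 :: real)) (at t within {a..b})"
    and j2: "((\<lambda>s. (t, s)) has_vector_derivative (0, 1)) (at 0 within {-\<epsilon><..<\<epsilon>})"
    by (auto intro!: derivative_eq_intros)
  note bil = bilinear_ladd[OF bilinear_metric] bilinear_radd[OF bilinear_metric]
    bilinear_lsub[OF bilinear_metric] bilinear_rsub[OF bilinear_metric]

  \<comment> \<open>Both arguments of the metric are the velocity, so by symmetry each term of the
    product rule occurs twice; \<open>e\<close> is one copy.\<close>
  define e where "e = g p (nab p x (const_field A c v)) v + g p f12 v"
  have "((\<lambda>s. chart_metric A g c (f (t, s)) (f1 (t, s)) (f1 (t, s))) has_real_derivative 2 * e)
      (at 0 within {-\<epsilon><..<\<epsilon>})"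
    by (rule DERIV_cong[OF chart_metric_along[OF c(1) f f1 f1 W(2) ft s0 j2]])
      (simp add: G DG e_def metric_commute[of p v] flip: v_def x_def f12_def f2_def[THEN fun_cong])
  then have "((\<lambda>s. energy s t) has_vector_derivative 2 * e) (at 0 within {-\<epsilon><..<\<epsilon>})"
    unfolding has_real_derivative_iff_has_vector_derivative
  proof (rule has_vector_derivative_near[where W = W and j = "\<lambda>s. (t, s)"])
    fix s assume s: "s \<in> {-\<epsilon><..<\<epsilon>}" "(t, s) \<in> W"
    show "chart_metric A g c (f (t, s)) (f1 (t, s)) (f1 (t, s)) = energy s t"
      using dom[OF t s] c(1)
      by (simp add: energy_def velocity[OF t s] chart_metric_coord flip: rep[OF t s])
  qed (use W s0 in auto)
  then have 1: "((\<lambda>s. energy s t) has_real_derivative 2 * e) (at 0)"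
    unfolding at_within_open[OF s0 open_greaterThanLessThan]
      has_real_derivative_iff_has_vector_derivative .

  have "((\<lambda>u. f1 (u, 0)) has_vector_derivative f11) (at t within {a..b})"
    unfolding f11_def by (rule frechet_derivative_direction[OF f1 W(2) j1])
  then have "((\<lambda>u. components A c (\<Gamma> 0 u) (\<gamma>' u)) has_vector_derivative f11) (at t within {a..b})"
  proof (rule has_vector_derivative_near[where W = W and j = "\<lambda>u. (u, 0)"])
    fix u assume u: "u \<in> {a..b}" "(u, 0) \<in> W"
    show "f1 (u, 0) = components A c (\<Gamma> 0 u) (\<gamma>' u)"
      using dom[OF u(1) s0 u(2)] c(1)
      by (simp add: \<gamma>'_def velocity[OF u(1) s0 u(2)] components_const_field transition_self)
  qed (use W t in auto)
  \<comment> \<open>In the chart \<open>c\<close> the components of the velocity are the first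
    partial derivatives of \<open>f\<close>, so differentiating them gives
    \<open>f11\<close>.\<close>
  then have cov: "cov_deriv_along A nab {a..b} (\<Gamma> 0) \<gamma>' t = f11 + nab p v (const_field A c v)"
    using at_within_nontrivial(1)[OF t]
    by (simp add: cov_deriv_along_def Let_def vector_derivative_within at_t
        flip: p_def c_def \<gamma>'_def)
  have tors: "torsion A nab p x v = nab p x (const_field A c v) - nab p v (const_field A c x)"
    by (simp add: torsion_eq c_def)

  define e' where "e' = g p (nab p v (const_field A c x)) v + g p x (nab p v (const_field A c v)) +
      g p f12 v + g p x f11"
  have "((\<lambda>u. chart_metric A g c (f (u, 0)) (f2 (u, 0)) (f1 (u, 0))) has_real_derivative e')
      (at t within {a..b})"
    by (rule DERIV_cong[OF chart_metric_along[OF c(1) f f2 f1 W(2) ft t j1]])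
      (simp add: G DG e'_def f21 flip: v_def x_def f11_def f1_def[THEN fun_cong])
  then have "((\<lambda>u. g (\<Gamma> 0 u) (X u) (\<gamma>' u)) has_vector_derivative e') (at t within {a..b})"
    unfolding has_real_derivative_iff_has_vector_derivative
  proof (rule has_vector_derivative_near[where W = W and j = "\<lambda>u. (u, 0)"])
    fix u assume u: "u \<in> {a..b}" "(u, 0) \<in> W"
    show "chart_metric A g c (f (u, 0)) (f2 (u, 0)) (f1 (u, 0)) = g (\<Gamma> 0 u) (X u) (\<gamma>' u)"
      using dom[OF u(1) s0 u(2)] c(1)
      by (simp add: \<gamma>'_def velocity[OF u(1) s0 u(2)] X'[OF u] chart_metric_coord
          flip: rep[OF u(1) s0 u(2)])
  qed (use W t in auto)
  moreover have "e' = e + (g p x (f11 + nab p v (const_field A c v)) - g p (torsion A nab p x v) v)"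
    by (simp add: e_def e'_def tors bil)
  ultimately have 2: "((\<lambda>t. g (\<Gamma> 0 t) (X t) (\<gamma>' t)) has_real_derivative
      e + (g (\<Gamma> 0 t) (X t) (cov_deriv_along A nab {a..b} (\<Gamma> 0) \<gamma>' t) -
        g (\<Gamma> 0 t) (torsion A nab (\<Gamma> 0 t) (X t) (\<gamma>' t)) (\<gamma>' t))) (at t within {a..b})"
    by (simp add: cov at_t has_real_derivative_iff_has_vector_derivative flip: p_def)
  from 1 2 show thesis by (rule that)
qed

lemma first_variation_of_length:
  assumes compat: "metric_compatible A g nab"
    and X: "\<And>t. t \<in> {a..b} \<Longrightarrow> X t = velocity A {-\<epsilon><..<\<epsilon>} (\<lambda>s. \<Gamma> s t) 0"
    and r: "0 < r" "\<And>t. t \<in> {a..b} \<Longrightarrow> speed A g {a..b} (\<Gamma> 0) t = r"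
  defines "\<gamma>' \<equiv> velocity A {a..b} (\<Gamma> 0)"
  shows "((\<lambda>s. curve_length A g a b (\<Gamma> s)) has_real_derivative
    1 / r * (g (\<Gamma> 0 b) (X b) (\<gamma>' b) - g (\<Gamma> 0 a) (X a) (\<gamma>' a)
      - integral {a..b} (\<lambda>t.
          g (\<Gamma> 0 t) (X t) (cov_deriv_along A nab {a..b} (\<Gamma> 0) \<gamma>' t)
          - g (\<Gamma> 0 t) (torsion A nab (\<Gamma> 0 t) (X t) (\<gamma>' t)) (\<gamma>' t)))) (at 0)"
proof -
  define I where "I = (\<lambda>t. g (\<Gamma> 0 t) (X t) (cov_deriv_along A nab {a..b} (\<Gamma> 0) \<gamma>' t)
      - g (\<Gamma> 0 t) (torsion A nab (\<Gamma> 0 t) (X t) (\<gamma>' t)) (\<gamma>' t))"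
  define \<phi> where "\<phi> = (\<lambda>t. g (\<Gamma> 0 t) (X t) (\<gamma>' t))"
  define L where "L = (\<lambda>s. curve_length A g a b (\<Gamma> s))"
  have s0: "0 \<in> {-\<epsilon><..<\<epsilon>}" using interval by simp
  \<comment> \<open>The number \<open>e\<close> is obtained separately for each \<open>t\<close>.
    Recording the derivative of \<open>L\<close> with it is what later shows that all these numbers
    coincide.\<close>
  have pt: "\<exists>e. (L has_real_derivative (b - a) * e / r) (at 0) \<and>
      (\<phi> has_real_derivative e + I t) (at t within {a..b})" if t: "t \<in> {a..b}" for t
  proof -
    obtain e where e: "((\<lambda>s. energy s t) has_real_derivative 2 * e) (at 0)"
      "(\<phi> has_real_derivative e + I t) (at t within {a..b})"
      unfolding \<phi>_def I_def \<gamma>'_def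
      by (rule variation_at_point[OF compat X t]) (assumption | rule that)+
    have sqrt_r: "sqrt (energy 0 t) = r" using r(2)[OF t] by (simp add: speed_def energy_def)
    with r(1) have "0 < energy 0 t" by auto
    \<comment> \<open>The derivative of the root is \<open>2 * e / (2 * r)\<close>; positivity of
      \<open>r\<close> keeps it away from the singularity at zero.\<close>
    then have "((\<lambda>s. (b - a) * sqrt (energy s t)) has_real_derivative (b - a) * e / r) (at 0)"
      using r(1) by (auto intro!: derivative_eq_intros e(1) simp: sqrt_r field_simps)
    then have "((\<lambda>s. (b - a) * sqrt (energy s t)) has_vector_derivative (b - a) * e / r)
        (at 0 within {-\<epsilon><..<\<epsilon>})"
      by (simp add: has_real_derivative_iff_has_vector_derivative
          at_within_open[OF s0 open_greaterThanLessThan])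
    then have "(L has_vector_derivative (b - a) * e / r) (at 0 within {-\<epsilon><..<\<epsilon>})"
      by (rule has_vector_derivative_transform[rotated 2])
        (use interval curve_length_eq t in \<open>auto simp: L_def\<close>)
    with e(2) show ?thesis
      by (auto simp: has_real_derivative_iff_has_vector_derivative
          at_within_open[OF s0 open_greaterThanLessThan])
  qed
  obtain e where e: "(L has_real_derivative (b - a) * e / r) (at 0)"
    using pt[of a] interval by auto
  have "(\<phi> has_vector_derivative e + I t) (at t within {a..b})" if t: "t \<in> {a..b}" for t
  proof -
    obtain e' where e': "(L has_real_derivative (b - a) * e' / r) (at 0)"
      "(\<phi> has_real_derivative e' + I t) (at t within {a..b})" using pt[OF t] by blast
    \<comment> \<open>The derivative of \<open>L\<close> is unique, and the factor
      \<open>(b - a) / r\<close> is nonzero.\<close>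
    have "e' = e" using DERIV_unique[OF e e'(1)] interval r(1) by simp
    with e' show ?thesis by (simp add: has_real_derivative_iff_has_vector_derivative)
  qed
  \<comment> \<open>The fundamental theorem also supplies the integrability of \<open>I\<close>,
    because \<open>e\<close> is now a constant; continuity of \<open>I\<close> need not be
    shown.\<close>
  then have "((\<lambda>t. e + I t) has_integral \<phi> b - \<phi> a) {a..b}"
    using interval by (intro fundamental_theorem_of_calculus) auto
  from has_integral_diff[OF this has_integral_const_real[of e a b]]
  have "(I has_integral \<phi> b - \<phi> a - (b - a) * e) {a..b}"
    using interval by simp
  then have "integral {a..b} I = \<phi> b - \<phi> a - (b - a) * e"
    by (rule integral_unique)
  then have "(b - a) * e / r = 1 / r * (\<phi> b - \<phi> a - integral {a..b} I)"
    by simp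
  with e show ?thesis by (simp add: L_def \<phi>_def I_def)
qed

end

theorem theorem9:
  fixes A :: "('a::{t2_space, second_countable_topology}, 'm::finite) chart set"
    and n :: nat
    and T10 :: "('a, 'm) cdistribution"
    and \<theta> :: "('a, 'm) form"
    and T :: "('a, 'm) field"
    and J :: "'a \<Rightarrow> real^'m \<Rightarrow> real^'m"
    and g :: "('a, 'm) metric"
    and nab :: "('a, 'm) connection"
    and \<Gamma> :: "real \<Rightarrow> real \<Rightarrow> 'a"
    and X :: "real \<Rightarrow> real^'m"
    and a b \<epsilon> r :: real
  assumes manifold: "smooth_atlas A" "orientable A" "CARD('m) = 2 * n + 1"
    and cr: "cr_structure A n T10"
    and contact: "pseudohermitian_form A T10 \<theta>"
    and reeb: "characteristic_field A \<theta> T"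
    and J: "cr_complex_structure T10 T J"
    and pos: "levi_positive_definite A T10 \<theta> J"
    and metric: "webster_metric A T10 \<theta> T J g"
    and connection: "tanaka_webster_connection A T10 \<theta> T J g nab"
    and interval: "a < b" "0 < \<epsilon>"
    and smooth: "smooth_map_on A ({a..b} \<times> {-\<epsilon><..<\<epsilon>}) (\<lambda>(t, s). \<Gamma> s t)"
    and arclength: "\<And>s. \<bar>s\<bar> < \<epsilon> \<Longrightarrow> proportional_to_arclength A g a b (\<Gamma> s)"
    and X: "\<And>t. t \<in> {a..b} \<Longrightarrow> X t = velocity A {-\<epsilon><..<\<epsilon>} (\<lambda>s. \<Gamma> s t) 0"
    and r: "0 < r" "\<And>t. t \<in> {a..b} \<Longrightarrow> speed A g {a..b} (\<Gamma> 0) t = r"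
  defines "\<gamma> \<equiv> \<Gamma> 0"
  defines "\<gamma>' \<equiv> velocity A {a..b} (\<Gamma> 0)"
  shows "((\<lambda>s. curve_length A g a b (\<Gamma> s)) has_real_derivative
    1 / r * (g (\<gamma> b) (X b) (\<gamma>' b) - g (\<gamma> a) (X a) (\<gamma>' a)
      - integral {a..b} (\<lambda>t.
          g (\<gamma> t) (X t) (cov_deriv_along A nab {a..b} \<gamma> \<gamma>' t)
          - g (\<gamma> t) (torsion A nab (\<gamma> t) (X t) (\<gamma>' t)) (\<gamma>' t)))) (at 0)"
proof -
  have g: "riemannian_metric A g" using metric by (simp add: webster_metric_def)
  have nab: "metric_compatible A g nab"
    using connection by (simp add: tanaka_webster_connection_def metric_compatible_def)
  interpret arclength_family A g \<Gamma> a b \<epsilon>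
    using manifold(1) g interval smooth arclength by unfold_locales
  show ?thesis
    unfolding \<gamma>_def \<gamma>'_def by (rule first_variation_of_length[OF nab X r])
qed

end
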